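(* Let $\{\omega_e\}_{e\in E}$ be i.i.d. weights on the edges of the complete bipartite graph $K_{n,n}$ with $\psi(\beta)=\log \mathbb{E}e^{-\beta\omega_e}<\infty$ for all $\beta\in[0,\infty)$, and let $Z(\beta,\boldsymbol\omega)=\frac1{n!}\sum_{\pi\in\mathcal M}e^{-\beta W(\pi)}$ be the partition function over perfect matchings. Then for any fixed $\beta\in[0,\infty)$, as $n\to\infty$, $$\log Z(\beta,\boldsymbol\omega)-n\psi(\beta)\Rightarrow \mathrm{N}\left(-v_\beta^2/2,\,v_\beta^2\right),$$ where $\Rightarrow$ denotes convergence in distribution and $v_\beta^2=e^{\psi(2\beta)-2\psi(\beta)}-1$.
   Context: $E$ is the edge set of $K_{n,n}$ and $\mathcal M$ is the set of all $n!$ perfect matchings of $K_{n,n}$ (each identified with its set of $n$ edges). The law of $\omega_e$ does not depend on $n$; $\boldsymbol\omega=(\omega_e)_{e\in E}$. The weights may be negative, and may equal $+\infty$ with positive probability (but not almost surely), with the convention $e^{-\beta\cdot(+\infty)}=0$ for every $\beta\ge 0$. For $\pi\in\mathcal M$, $W(\pi)=\sum_{e\in\pi}\omega_e$. $\mathrm{N}(\mu,\sigma^2)$ is the normal distribution with mean $\mu$ and variance $\sigma^2$. If $Z=0$, $\log Z=-\infty$. *)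

theory Defs
  imports "HOL-Probability.Probability"
begin

text \<open>Edges of \<open>K\<^sub>n\<^sub>,\<^sub>n\<close>: the pair \<open>(i, j)\<close> is the edge joining the left vertex \<open>i\<close> to the right
  vertex \<open>j\<close>.\<close>

definition Knn_edges :: "nat \<Rightarrow> (nat \<times> nat) set" where
  "Knn_edges n = {..<n} \<times> {..<n}"

definition perfect_matchings :: "nat \<Rightarrow> (nat \<times> nat) set set" where
  "perfect_matchings n =
     {\<pi>. \<pi> \<subseteq> Knn_edges n \<and> (\<forall>i<n. \<exists>!j. (i, j) \<in> \<pi>) \<and> (\<forall>j<n. \<exists>!i. (i, j) \<in> \<pi>)}"

text \<open>\<open>boltzmann \<beta> w\<close> is \<open>e\<^bsup>-\<beta>w\<^esup>\<close> for \<open>w \<in> (-\<infinity>, \<infinity>]\<close>, with value \<open>0\<close> at \<open>w = \<infinity>\<close> even when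
  \<open>\<beta> = 0\<close>. The value at \<open>w = -\<infinity>\<close> carries no meaning.\<close>

definition boltzmann :: "real \<Rightarrow> ereal \<Rightarrow> real" where
  "boltzmann \<beta> w = (if w = \<infinity> then 0 else exp (- \<beta> * real_of_ereal w))"

definition matching_weight :: "(nat \<times> nat \<Rightarrow> ereal) \<Rightarrow> (nat \<times> nat) set \<Rightarrow> ereal" where
  "matching_weight w \<pi> = (\<Sum>e\<in>\<pi>. w e)"

definition partition_function :: "nat \<Rightarrow> real \<Rightarrow> (nat \<times> nat \<Rightarrow> ereal) \<Rightarrow> real" where
  "partition_function n \<beta> w =
     1 / fact n * (\<Sum>\<pi>\<in>perfect_matchings n. boltzmann \<beta> (matching_weight w \<pi>))"

definition log_ext :: "real \<Rightarrow> ereal" where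
  "log_ext z = (if z = 0 then -\<infinity> else ereal (ln z))"

text \<open>\<open>\<psi>(\<beta>)\<close> for weights of law \<open>\<mu>\<close>. It is finite exactly when the integrand is integrable
  and \<open>\<mu>\<close> is not concentrated at \<open>\<infinity>\<close>.\<close>

definition log_mgf :: "ereal measure \<Rightarrow> real \<Rightarrow> real" where
  "log_mgf \<mu> \<beta> = ln (\<integral>w. boltzmann \<beta> w \<partial>\<mu>)"

definition limit_variance :: "ereal measure \<Rightarrow> real \<Rightarrow> real" where
  "limit_variance \<mu> \<beta> = exp (log_mgf \<mu> (2 * \<beta>) - 2 * log_mgf \<mu> \<beta>) - 1"

text \<open>The normal law with mean \<open>m\<close> and variance \<open>v \<ge> 0\<close>; for \<open>v = 0\<close> it is the point mass at \<open>m\<close>.\<close>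

definition normal_law :: "real \<Rightarrow> real \<Rightarrow> real measure" where
  "normal_law m v =
     (if v = 0 then return borel m else density lborel (\<lambda>x. ennreal (normal_density m (sqrt v) x)))"

text \<open>Convergence in distribution of extended real random variables, the \<open>n\<close>-th one living on
  \<open>M n\<close>, to a probability law on the reals. A variable may charge \<open>-\<infinity>\<close> or \<open>\<infinity>\<close>; its distribution
  function is still determined on the reals, and since the limit is a proper distribution
  function, such mass must vanish in the limit.\<close>

definition converges_in_distribution ::
    "(nat \<Rightarrow> 'a measure) \<Rightarrow> (nat \<Rightarrow> 'a \<Rightarrow> ereal) \<Rightarrow> real measure \<Rightarrow> bool" where
  "converges_in_distribution M X N \<longleftrightarrow>
     weak_conv (\<lambda>n x. measure (M n) {\<xi> \<in> space (M n). X n \<xi> \<le> ereal x}) (cdf N)"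

end

theory Submission
  imports Defs "HOL-Real_Asymp.Real_Asymp"
begin

text \<open>
  Put \<open>X\<^sub>e = e\<^bsup>-\<beta>\<omega>\<^sub>e\<^esup> / e\<^bsup>\<psi>(\<beta>)\<^esup>\<close>, so that the \<open>X\<^sub>e\<close> are i.i.d., nonnegative, of mean \<open>1\<close> and variance
  \<open>s = v\<^sub>\<beta>\<^sup>2\<close>, and \<open>Z / e\<^bsup>n\<psi>(\<beta>)\<^esup>\<close> is the normalized permanent \<open>Z' = per(X) / n!\<close>. Compare it with the
  product \<open>P = \<Prod>\<^sub>e (1 + (X\<^sub>e - 1) / n)\<close> over all \<open>n\<^sup>2\<close> edges. By independence
  \<open>E[Z' P] = (1 + s/n)\<^sup>n\<close> and \<open>E[P\<^sup>2] = (1 + s/n\<^sup>2)\<close> to the power \<open>n\<^sup>2\<close>, while \<open>E[Z'\<^sup>2]\<close> is the average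
  of \<open>(1 + s)\<close> to the power \<open>|\<pi> \<inter> \<sigma>|\<close> over pairs of matchings, which is at most \<open>e\<^sup>s\<close>. Hence
  \<open>E[(Z' - P)\<^sup>2] \<rightarrow> e\<^sup>s - 2 e\<^sup>s + e\<^sup>s = 0\<close>. Finally \<open>log P\<close> is a sum of \<open>n\<^sup>2\<close> i.i.d. terms, each with
  characteristic function \<open>1 - (it + t\<^sup>2) s / (2n\<^sup>2) + O(n\<^sup>-\<^sup>3)\<close>, so it converges to \<open>N(-s/2, s)\<close> by Levy's
  continuity theorem.
\<close>

section \<open>Counting perfect matchings and their overlaps\<close>

section \<open>Matchings\<close>

text \<open>The vertex sets are arbitrary because deleting edges of a matching leaves a matching of
  the remaining vertices, which no longer form initial segments of the naturals.\<close>

definition matchings_between :: "'a set \<Rightarrow> 'b set \<Rightarrow> ('a \<times> 'b) set set" where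
  "matchings_between A B =
     {\<pi>. \<pi> \<subseteq> A \<times> B \<and> (\<forall>i\<in>A. \<exists>!j. (i, j) \<in> \<pi>) \<and> (\<forall>j\<in>B. \<exists>!i. (i, j) \<in> \<pi>)}"

lemma perfect_matchings_eq: "perfect_matchings n = matchings_between {..<n} {..<n}"
  by (simp add: perfect_matchings_def matchings_between_def Knn_edges_def Ball_def)

lemma finite_matchings_between: "finite A \<Longrightarrow> finite B \<Longrightarrow> finite (matchings_between A B)"
  by (rule finite_subset[of _ "Pow (A \<times> B)"]) (auto simp: matchings_between_def)

lemma finite_matching: "finite A \<Longrightarrow> finite B \<Longrightarrow> \<pi> \<in> matchings_between A B \<Longrightarrow> finite \<pi>"
  by (rule finite_subset[of _ "A \<times> B"]) (auto simp: matchings_between_def)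

lemma matching_unique:
  assumes "\<pi> \<in> matchings_between A B"
  shows "(i, j) \<in> \<pi> \<Longrightarrow> (i, j') \<in> \<pi> \<Longrightarrow> j = j'"
    and "(i, j) \<in> \<pi> \<Longrightarrow> (i', j) \<in> \<pi> \<Longrightarrow> i = i'"
  using assms unfolding matchings_between_def by (fast, fast)

lemma inj_on_fst_matching: "\<pi> \<in> matchings_between A B \<Longrightarrow> inj_on fst \<pi>"
  by (rule inj_onI) (metis matching_unique(1) prod.collapse)

lemma inj_on_snd_matching: "\<pi> \<in> matchings_between A B \<Longrightarrow> inj_on snd \<pi>"
  by (rule inj_onI) (metis matching_unique(2) prod.collapse)

lemma card_matching:
  assumes "\<pi> \<in> matchings_between A B" shows "card \<pi> = card A"
proof -
  have "fst ` \<pi> = A" using assms unfolding matchings_between_def by force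
  then show ?thesis using card_image[OF inj_on_fst_matching[OF assms]] by simp
qed

text \<open>Partners are unique, so deleting \<open>S\<close> frees exactly the endpoints of
  \<open>S\<close>. This serves both the recursion for the number of matchings and the count of
  matchings containing \<open>S\<close>.\<close>

lemma matchings_between_diff:
  assumes "\<pi> \<in> matchings_between A B" "S \<subseteq> \<pi>"
  shows "\<pi> - S \<in> matchings_between (A - fst ` S) (B - snd ` S)"
proof -
  note * = matching_unique[OF assms(1)]
  have sub: "\<pi> \<subseteq> A \<times> B" and ex: "\<And>i. i \<in> A \<Longrightarrow> \<exists>j. (i, j) \<in> \<pi>" "\<And>j. j \<in> B \<Longrightarrow> \<exists>i. (i, j) \<in> \<pi>"
    using assms(1) unfolding matchings_between_def by auto
  have mem_fst: "i \<in> fst ` S \<longleftrightarrow> (\<exists>j. (i, j) \<in> S)" and mem_snd: "j \<in> snd ` S \<longleftrightarrow> (\<exists>i. (i, j) \<in> S)"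
    for i j by force+
  have fst: "i \<notin> fst ` S" if "(i, j) \<in> \<pi> - S" for i j
    unfolding mem_fst using that *(1)[of i j] assms(2) by blast
  have snd: "j \<notin> snd ` S" if "(i, j) \<in> \<pi> - S" for i j
    unfolding mem_snd using that *(2)[of i j] assms(2) by blast
  have 1: "\<pi> - S \<subseteq> (A - fst ` S) \<times> (B - snd ` S)"
    using sub fst snd by blast
  have 2: "\<exists>!j. (i, j) \<in> \<pi> - S" if i: "i \<in> A - fst ` S" for i
  proof -
    obtain j where "(i, j) \<in> \<pi>" using ex(1) i by blast
    then show ?thesis using i *(1) unfolding Diff_iff mem_fst by blast
  qed
  have 3: "\<exists>!i. (i, j) \<in> \<pi> - S" if j: "j \<in> B - snd ` S" for j
  proof -
    obtain i where "(i, j) \<in> \<pi>" using ex(2) j by blast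
    then show ?thesis using j *(2) unfolding Diff_iff mem_snd by blast
  qed
  show ?thesis unfolding matchings_between_def by (intro CollectI conjI ballI 1 2 3)
qed

lemma insert_matching:
  assumes "\<pi> \<in> matchings_between A (B - {b})" "a \<notin> A" "b \<in> B"
  shows "insert (a, b) \<pi> \<in> matchings_between (insert a A) B"
proof -
  note * = matching_unique[OF assms(1)]
  have sub: "\<pi> \<subseteq> A \<times> (B - {b})" and ex: "\<And>i. i \<in> A \<Longrightarrow> \<exists>j. (i, j) \<in> \<pi>"
      "\<And>j. j \<in> B - {b} \<Longrightarrow> \<exists>i. (i, j) \<in> \<pi>"
    using assms(1) unfolding matchings_between_def by auto
  have 1: "insert (a, b) \<pi> \<subseteq> insert a A \<times> B" using sub assms by auto
  have 2: "\<exists>!j. (i, j) \<in> insert (a, b) \<pi>" if "i \<in> insert a A" for i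
    using that ex(1)[of i] *(1) sub \<open>a \<notin> A\<close> by blast
  have 3: "\<exists>!i. (i, j) \<in> insert (a, b) \<pi>" if "j \<in> B" for j
    using that ex(2)[of j] *(2) sub by blast
  show ?thesis unfolding matchings_between_def by (intro CollectI conjI ballI 1 2 3)
qed

text \<open>Sorts the matchings by the partner \<open>b\<close> of the new vertex \<open>a\<close>;
  removing the edge \<open>(a, b)\<close> leaves a matching of the rest.\<close>

lemma matchings_between_insert:
  assumes "a \<notin> A"
  shows "matchings_between (insert a A) B =
    (\<Union>b\<in>B. insert (a, b) ` matchings_between A (B - {b}))" (is "?L = ?R")
proof
  show "?R \<subseteq> ?L"
  proof
    fix \<pi> assume "\<pi> \<in> ?R"
    then obtain b \<sigma> where "b \<in> B" "\<sigma> \<in> matchings_between A (B - {b})" "\<pi> = insert (a, b) \<sigma>"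
      by auto
    then show "\<pi> \<in> ?L" using insert_matching[of \<sigma> A B b a] assms by simp
  qed
  show "?L \<subseteq> ?R"
  proof
    fix \<pi> assume \<pi>: "\<pi> \<in> ?L"
    then obtain b where b: "(a, b) \<in> \<pi>" "b \<in> B" unfolding matchings_between_def by blast
    from matchings_between_diff[OF \<pi>, of "{(a, b)}"] b assms
    have "\<pi> - {(a, b)} \<in> matchings_between A (B - {b})" by simp
    moreover have "\<pi> = insert (a, b) (\<pi> - {(a, b)})" using b by auto
    ultimately show "\<pi> \<in> ?R" using b by blast
  qed
qed

lemma card_matchings_between:
  assumes "finite A" "finite B" "card A = card B"
  shows "card (matchings_between A B) = fact (card A)"
  using assms
proof (induction A arbitrary: B rule: finite_induct)
  case empty
  then have "matchings_between ({} :: 'a set) B = {{}}" by (auto simp: matchings_between_def)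
  then show ?case by simp
next
  case (insert a A)
  have notin: "(a, b) \<notin> \<pi>" if "\<pi> \<in> matchings_between A C" for b \<pi> and C :: "'b set"
    using that insert.hyps unfolding matchings_between_def by auto
  have "card (matchings_between (insert a A) B)
      = (\<Sum>b\<in>B. card (insert (a, b) ` matchings_between A (B - {b})))"
    unfolding matchings_between_insert[OF insert.hyps(2)]
  \<comment> \<open>The classes are disjoint: a smaller matching has no edge at \<open>a\<close>, so
    the partner of \<open>a\<close> can be read off from the enlarged one.\<close>
  proof (rule card_UN_disjoint)
    show "\<forall>i\<in>B. \<forall>j\<in>B. i \<noteq> j \<longrightarrow> insert (a, i) ` matchings_between A (B - {i})
        \<inter> insert (a, j) ` matchings_between A (B - {j}) = {}"
      using notin by blast
  qed (use insert in \<open>auto intro: finite_matchings_between\<close>)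
  also have "\<dots> = (\<Sum>b\<in>B. fact (card A))"
  proof (rule sum.cong)
    fix b assume b: "b \<in> B"
    have "inj_on (insert (a, b)) (matchings_between A (B - {b}))"
      by (rule inj_onI) (metis notin insert_ident)
    moreover have "card (matchings_between A (B - {b})) = fact (card A)"
      by (rule insert.IH) (use insert.prems insert.hyps b in simp_all)
    ultimately show "card (insert (a, b) ` matchings_between A (B - {b})) = fact (card A)"
      by (simp add: card_image)
  qed simp
  also have "\<dots> = fact (card (insert a A))"
    using insert.hyps insert.prems(2)[symmetric] by simp
  finally show ?case .
qed

text \<open>Removing \<open>S\<close> is injective on the matchings that contain \<open>S\<close>,
  and the images match the vertices that \<open>S\<close> misses. The matching \<open>\<pi>\<close>
  ensures that \<open>S\<close> uses each vertex at most once.\<close>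

lemma card_matchings_between_superset_le:
  assumes "finite A" "finite B" "card A = card B" "\<pi> \<in> matchings_between A B" "S \<subseteq> \<pi>"
  shows "card {\<sigma> \<in> matchings_between A B. S \<subseteq> \<sigma>} \<le> fact (card A - card S)"
proof -
  have fst: "card (fst ` S) = card S" and snd: "card (snd ` S) = card S"
    using inj_on_fst_matching[OF assms(4)] inj_on_snd_matching[OF assms(4)] assms(5)
    by (meson card_image inj_on_subset)+
  have sub: "fst ` S \<subseteq> A" "snd ` S \<subseteq> B"
    using assms(4,5) unfolding matchings_between_def by auto
  have "card {\<sigma> \<in> matchings_between A B. S \<subseteq> \<sigma>}
      \<le> card (matchings_between (A - fst ` S) (B - snd ` S))"
  proof (rule card_inj_on_le[where f = "\<lambda>\<sigma>. \<sigma> - S"])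
    show "inj_on (\<lambda>\<sigma>. \<sigma> - S) {\<sigma> \<in> matchings_between A B. S \<subseteq> \<sigma>}"
      by (rule inj_onI) blast
    show "(\<lambda>\<sigma>. \<sigma> - S) ` {\<sigma> \<in> matchings_between A B. S \<subseteq> \<sigma>}
        \<subseteq> matchings_between (A - fst ` S) (B - snd ` S)"
      using matchings_between_diff by blast
  qed (use assms in \<open>auto intro: finite_matchings_between\<close>)
  also have "\<dots> = fact (card (A - fst ` S))"
    using assms sub fst snd
    by (intro card_matchings_between) (auto simp: card_Diff_subset finite_subset)
  also have "card (A - fst ` S) = card A - card S"
    using sub fst assms(1) by (simp add: card_Diff_subset finite_subset)
  finally show ?thesis .
qed

text \<open>Binomial theorem indexed by subsets: each factor \<open>s + 1\<close> of the product
  over \<open>T\<close> either selects its element or not.\<close>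

lemma power_card_add_one:
  fixes s :: "'a :: comm_semiring_1"
  assumes "finite T"
  shows "(1 + s) ^ card T = (\<Sum>S\<in>Pow T. s ^ card S)"
proof -
  have "(1 + s) ^ card T = (\<Prod>x\<in>T. s + 1)" by (simp add: add.commute)
  also have "\<dots> = (\<Sum>S\<in>Pow T. s ^ card S)" by (subst prod_add[OF assms]) simp
  finally show ?thesis .
qed

text \<open>Expand each power over the sets \<open>S\<close> of common edges and swap the sums.
  There are \<open>n choose k\<close> sets \<open>S\<close> of size \<open>k\<close> in
  \<open>\<pi>\<close>, each in at most \<open>(n - k)!\<close> matchings, so size \<open>k\<close>
  contributes at most \<open>n! * s^k / k!\<close>. In probabilistic terms, the overlap with a
  uniform matching is compared with a Poisson variable of mean 1.\<close>

lemma sum_power_overlap_le: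
  fixes s :: real
  assumes fin: "finite A" "finite B" "card A = card B" and \<pi>: "\<pi> \<in> matchings_between A B"
    and s: "0 \<le> s"
  shows "(\<Sum>\<sigma>\<in>matchings_between A B. (1 + s) ^ card (\<pi> \<inter> \<sigma>)) \<le> fact (card A) * exp s"
proof -
  let ?M = "matchings_between A B" and ?n = "card A"
  have finM: "finite ?M" using fin by (intro finite_matchings_between)
  have fin\<pi>: "finite \<pi>" using finite_matching[OF fin(1,2) \<pi>] .
  have "(\<Sum>\<sigma>\<in>?M. (1 + s) ^ card (\<pi> \<inter> \<sigma>))
      = (\<Sum>\<sigma>\<in>?M. \<Sum>S\<in>Pow \<pi>. if S \<subseteq> \<sigma> then s ^ card S else 0)"
  proof (rule sum.cong[OF refl])
    fix \<sigma>
    have "(1 + s) ^ card (\<pi> \<inter> \<sigma>) = (\<Sum>S\<in>Pow (\<pi> \<inter> \<sigma>). s ^ card S)"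
      using fin\<pi> by (intro power_card_add_one) simp
    also have "Pow (\<pi> \<inter> \<sigma>) = {S \<in> Pow \<pi>. S \<subseteq> \<sigma>}" by auto
    also have "(\<Sum>S\<in>{S \<in> Pow \<pi>. S \<subseteq> \<sigma>}. s ^ card S)
        = (\<Sum>S\<in>Pow \<pi>. if S \<subseteq> \<sigma> then s ^ card S else 0)"
      using fin\<pi> by (intro sum.inter_filter) simp
    finally show "(1 + s) ^ card (\<pi> \<inter> \<sigma>)
        = (\<Sum>S\<in>Pow \<pi>. if S \<subseteq> \<sigma> then s ^ card S else 0)" .
  qed
  also have "\<dots> = (\<Sum>S\<in>Pow \<pi>. \<Sum>\<sigma>\<in>?M. if S \<subseteq> \<sigma> then s ^ card S else 0)"
    by (rule sum.swap)
  also have "\<dots> = (\<Sum>S\<in>Pow \<pi>. real (card {\<sigma> \<in> ?M. S \<subseteq> \<sigma>}) * s ^ card S)"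
    using finM by (simp add: sum.inter_filter[symmetric])
  also have "\<dots> \<le> (\<Sum>S\<in>Pow \<pi>. fact (?n - card S) * s ^ card S)"
  proof (intro sum_mono mult_right_mono)
    fix S assume "S \<in> Pow \<pi>"
    then have "card {\<sigma> \<in> ?M. S \<subseteq> \<sigma>} \<le> fact (?n - card S)"
      using card_matchings_between_superset_le[OF fin \<pi>] by simp
    then show "real (card {\<sigma> \<in> ?M. S \<subseteq> \<sigma>}) \<le> fact (?n - card S)"
      using of_nat_mono by fastforce
  qed (use s in simp)
  also have "\<dots> = (\<Sum>k\<le>?n. \<Sum>S\<in>{S \<in> Pow \<pi>. card S = k}. fact (?n - card S) * s ^ card S)"
    using fin\<pi> card_matching[OF \<pi>] by (intro sum.group[symmetric]) (auto dest: card_mono)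
  also have "\<dots> = (\<Sum>k\<le>?n. fact ?n * (s ^ k / fact k))"
  proof (rule sum.cong[OF refl])
    fix k assume k: "k \<in> {..?n}"
    have "(\<Sum>S\<in>{S \<in> Pow \<pi>. card S = k}. fact (?n - card S) * s ^ card S)
        = real (card {S. S \<subseteq> \<pi> \<and> card S = k}) * (fact (?n - k) * s ^ k)"
      by simp
    also have "\<dots> = real (?n choose k) * (fact (?n - k) * s ^ k)"
      using n_subsets[OF fin\<pi>] card_matching[OF \<pi>] by simp
    also have "\<dots> = fact ?n * (s ^ k / fact k)"
      using k by (simp add: binomial_fact)
    finally show "(\<Sum>S\<in>{S \<in> Pow \<pi>. card S = k}. fact (?n - card S) * s ^ card S)
        = fact ?n * (s ^ k / fact k)" .
  qed
  also have "\<dots> = fact ?n * (\<Sum>k\<le>?n. s ^ k / fact k)"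
    by (simp add: sum_distrib_left)
  also have "(\<Sum>k\<le>?n. s ^ k / fact k) \<le> exp s"
    unfolding exp_def using s summable_exp[of s]
    by (auto simp: field_simps intro!: sum_le_suminf)
  finally show ?thesis by simp
qed

section \<open>Explicit remainder bounds for the logarithm and the exponential\<close>

section \<open>Taylor expansions\<close>

text \<open>The difference of the two sides has derivative \<open>x^2 / (1 + x)\<close>. The bound
  is quadratic for every nonnegative \<open>y\<close>, also for large \<open>y\<close>, where a
  cubic remainder would be too weak.\<close>

lemma ln_one_plus_ge_quadratic:
  fixes y :: real
  assumes "0 \<le> y"
  shows "y - y\<^sup>2 / 2 \<le> ln (1 + y)"
proof -
  define f where "f = (\<lambda>y::real. ln (1 + y) - y + y\<^sup>2 / 2)"
  have "f 0 \<le> f y"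
  proof (rule DERIV_nonneg_imp_nondecreasing[OF assms], intro exI conjI)
    fix x :: real assume x: "0 \<le> x" "x \<le> y"
    then show "(f has_real_derivative x\<^sup>2 / (1 + x)) (at x)"
      unfolding f_def by (auto intro!: derivative_eq_intros simp: field_simps power2_eq_square)
    show "0 \<le> x\<^sup>2 / (1 + x)" using x by simp
  qed
  then show ?thesis by (simp add: f_def)
qed

text \<open>The remainder \<open>f\<close> and \<open>y^3 - f\<close> both vanish at 0 and are
  nondecreasing from -1/2 on, so \<open>f\<close> lies between 0 and \<open>y^3\<close>.\<close>

lemma ln_one_plus_taylor3:
  fixes y :: real
  assumes "- 1 / 2 \<le> y"
  shows "\<bar>ln (1 + y) - y + y\<^sup>2 / 2\<bar> \<le> \<bar>y\<bar> ^ 3"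
proof -
  define f g where "f = (\<lambda>y::real. ln (1 + y) - y + y\<^sup>2 / 2)" and "g = (\<lambda>y. y ^ 3 - f y)"
  have df: "(f has_real_derivative x\<^sup>2 / (1 + x)) (at x)" if "- 1 / 2 \<le> x" for x
    unfolding f_def using that
    by (auto intro!: derivative_eq_intros simp: field_simps power2_eq_square)
  have dg: "(g has_real_derivative 3 * x\<^sup>2 - x\<^sup>2 / (1 + x)) (at x)" if "- 1 / 2 \<le> x" for x
    using DERIV_diff[OF DERIV_pow[of 3 x] df[OF that]] by (simp add: g_def)
  have f_mono: "f a \<le> f b" if "- 1 / 2 \<le> a" "a \<le> b" for a b
  proof (rule DERIV_nonneg_imp_nondecreasing[OF that(2)], intro exI conjI)
    fix x assume x: "a \<le> x" "x \<le> b"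
    then show "(f has_real_derivative x\<^sup>2 / (1 + x)) (at x)" using that by (intro df) simp
    show "0 \<le> x\<^sup>2 / (1 + x)" using x that by simp
  qed
  have g_mono: "g a \<le> g b" if "- 1 / 2 \<le> a" "a \<le> b" for a b
  proof (rule DERIV_nonneg_imp_nondecreasing[OF that(2)], intro exI conjI)
    fix x assume x: "a \<le> x" "x \<le> b"
    then show "(g has_real_derivative 3 * x\<^sup>2 - x\<^sup>2 / (1 + x)) (at x)" using that by (intro dg) simp
    \<comment> \<open>Here \<open>x \<ge> -1/2\<close> gives \<open>3 * (1 + x) \<ge> 3/2\<close>,
      so \<open>x^2 / (1 + x)\<close> is at most \<open>3 * x^2\<close>.\<close>
    have "x\<^sup>2 * 1 \<le> x\<^sup>2 * (3 * (1 + x))" using x that by (intro mult_left_mono) auto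
    then show "0 \<le> 3 * x\<^sup>2 - x\<^sup>2 / (1 + x)" using x that by (simp add: field_simps)
  qed
  have 0: "f 0 = 0" "g 0 = 0" by (simp_all add: f_def g_def)
  show ?thesis
  proof (cases "0 \<le> y")
    case True
    then show ?thesis using f_mono[of 0 y] g_mono[of 0 y] 0 by (simp add: g_def f_def)
  next
    case False
    then show ?thesis using f_mono[of y 0] g_mono[of y 0] 0 assms
      by (simp add: g_def f_def)
  qed
qed

text \<open>This is the second-order expansion of \<open>(1 + y)\<close> to the power
  \<open>it\<close>, whose quadratic coefficient is
  \<open>it (it - 1) / 2 = - (it + t^2) / 2\<close>. With \<open>u = ln (1 + y)\<close>, expand in
  \<open>u\<close>, then replace \<open>u\<close> by \<open>y - y^2 / 2\<close> and
  \<open>u^2\<close> by \<open>y^2\<close>. No upper bound on \<open>y\<close> is imposed, since the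
  weights are unbounded.\<close>

lemma iexp_ln_one_plus_taylor:
  fixes y t :: real
  assumes y: "- 1 / 2 \<le> y"
  shows "cmod (iexp (t * ln (1 + y)) - (1 + \<i> * t * y - (\<i> * t + t\<^sup>2) / 2 * y\<^sup>2))
    \<le> (2 * \<bar>t\<bar> ^ 3 + \<bar>t\<bar> + 2 * t\<^sup>2) * \<bar>y\<bar> ^ 3"
proof -
  define u where "u = ln (1 + y)"
  have cubic: "\<bar>u - y + y\<^sup>2 / 2\<bar> \<le> \<bar>y\<bar> ^ 3"
    using ln_one_plus_taylor3[OF y] by (simp add: u_def)
  have u_le: "u \<le> y" using y unfolding u_def by (intro ln_add_one_self_le_self2) simp
  \<comment> \<open>The cubic bound suffices for negative \<open>y\<close>, where
    \<open>\<bar>y\<bar> \<le> 1/2\<close>; nonnegative \<open>y\<close> may be large and needs the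
    quadratic bound.\<close>
  have diff: "y - u \<le> y\<^sup>2"
  proof (cases "0 \<le> y")
    case True
    have "y - y\<^sup>2 / 2 \<le> u"
      using ln_one_plus_ge_quadratic True by (simp add: u_def)
    then have "y - u \<le> y\<^sup>2 / 2" by simp
    also have "\<dots> \<le> y\<^sup>2" by simp
    finally show ?thesis .
  next
    case False
    have "y\<^sup>2 * \<bar>y\<bar> \<le> y\<^sup>2 * (1 / 2)" using False y by (intro mult_left_mono) auto
    then have "\<bar>y\<bar> ^ 3 \<le> y\<^sup>2 / 2" by (simp add: power3_eq_cube power2_eq_square abs_mult)
    then show ?thesis using cubic by linarith
  qed
  have u_abs: "\<bar>u\<bar> \<le> 2 * \<bar>y\<bar>"
  proof (cases "0 \<le> y")
    case True
    then show ?thesis using u_le by (simp add: u_def)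
  next
    case False
    have "\<bar>y\<bar> * \<bar>y\<bar> \<le> 1 * \<bar>y\<bar>" using False y by (intro mult_right_mono) auto
    then have "y\<^sup>2 \<le> \<bar>y\<bar>" by (simp add: power2_eq_square)
    then show ?thesis using diff u_le False by linarith
  qed
  have sq: "\<bar>u\<^sup>2 - y\<^sup>2\<bar> \<le> 3 * \<bar>y\<bar> ^ 3"
  proof -
    have "\<bar>u\<^sup>2 - y\<^sup>2\<bar> = \<bar>u - y\<bar> * \<bar>u + y\<bar>"
      by (simp add: abs_mult[symmetric] power2_eq_square algebra_simps)
    also have "\<dots> \<le> y\<^sup>2 * (3 * \<bar>y\<bar>)"
      using diff u_le u_abs by (intro mult_mono) auto
    also have "\<dots> = 3 * \<bar>y\<bar> ^ 3"
      by (simp add: power3_eq_cube power2_eq_square abs_mult)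
    finally show ?thesis .
  qed
  have cube: "\<bar>t * u\<bar> ^ 3 \<le> \<bar>t\<bar> ^ 3 * (8 * \<bar>y\<bar> ^ 3)"
  proof -
    have "\<bar>u\<bar> ^ 3 \<le> (2 * \<bar>y\<bar>) ^ 3" using u_abs by (intro power_mono) auto
    then show ?thesis by (simp add: abs_mult power_mult_distrib mult_left_mono)
  qed
  have sum: "(\<Sum>k\<le>2. (\<i> * complex_of_real x) ^ k / fact k) = 1 + \<i> * x - x\<^sup>2 / 2" for x :: real
    by (simp add: numeral_2_eq_2 power_mult_distrib)
  have "fact (Suc 2) = (6 :: real)" by (simp add: numeral_2_eq_2)
  then have "cmod (iexp (t * u) - (1 + \<i> * (t * u) - (t * u)\<^sup>2 / 2)) \<le> \<bar>t * u\<bar> ^ 3 / 6"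
    using iexp_approx1[of "t * u" 2] unfolding sum by simp
  also have "\<dots> \<le> 2 * \<bar>t\<bar> ^ 3 * \<bar>y\<bar> ^ 3"
  proof -
    have "0 \<le> \<bar>t\<bar> ^ 3 * \<bar>y\<bar> ^ 3" by simp
    then show ?thesis using cube by linarith
  qed
  finally have 1: "cmod (iexp (t * u) - (1 + \<i> * (t * u) - (t * u)\<^sup>2 / 2)) \<le> 2 * \<bar>t\<bar> ^ 3 * \<bar>y\<bar> ^ 3" .
  \<comment> \<open>Three errors: the exponential remainder, the error in the linear term, and the
    error in the quadratic term.\<close>
  have "iexp (t * u) - (1 + \<i> * t * y - (\<i> * t + t\<^sup>2) / 2 * y\<^sup>2)
      = (iexp (t * u) - (1 + \<i> * (t * u) - (t * u)\<^sup>2 / 2))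
        + (\<i> * (t * (u - y + y\<^sup>2 / 2)) - of_real (t\<^sup>2 / 2 * (u\<^sup>2 - y\<^sup>2)))"
    by (simp add: algebra_simps power_mult_distrib add_divide_distrib diff_divide_distrib)
  also have "cmod \<dots> \<le> 2 * \<bar>t\<bar> ^ 3 * \<bar>y\<bar> ^ 3 + (\<bar>t\<bar> * \<bar>y\<bar> ^ 3 + t\<^sup>2 / 2 * (3 * \<bar>y\<bar> ^ 3))"
  proof (rule norm_triangle_mono[OF 1 order_trans[OF norm_triangle_ineq4 add_mono]])
    show "cmod (\<i> * (t * (u - y + y\<^sup>2 / 2))) \<le> \<bar>t\<bar> * \<bar>y\<bar> ^ 3"
      using cubic by (simp add: norm_mult abs_mult mult_left_mono flip: of_real_add of_real_diff of_real_power of_real_divide of_real_mult)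
    show "cmod (of_real (t\<^sup>2 / 2 * (u\<^sup>2 - y\<^sup>2))) \<le> t\<^sup>2 / 2 * (3 * \<bar>y\<bar> ^ 3)"
      using sq by (simp only: norm_of_real abs_mult) (simp add: mult_left_mono)
  qed
  also have "\<dots> \<le> (2 * \<bar>t\<bar> ^ 3 + \<bar>t\<bar> + 2 * t\<^sup>2) * \<bar>y\<bar> ^ 3"
    by (simp add: algebra_simps)
  finally show ?thesis by (simp add: u_def)
qed

text \<open>The remainder is quadratic in \<open>z / n^2\<close>, hence of order
  \<open>n^-4\<close>: even multiplied by \<open>n^2\<close> it tends to 0. For
  \<open>n \<ge> 1\<close> the exponential prefactor is bounded uniformly in
  \<open>n\<close>.\<close>

lemma norm_exp_over_square_taylor_le:
  fixes z :: complex
  assumes n: "1 \<le> (n :: nat)"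
  shows "cmod (exp (z / n\<^sup>2) - (1 + z / n\<^sup>2)) \<le> exp (cmod z) * (cmod z)\<^sup>2 / n ^ 4"
proof -
  define w where "w = z / n\<^sup>2"
  have "1 \<le> real n ^ 2" using n by simp
  then have "cmod z / n\<^sup>2 \<le> cmod z / 1" using n by (intro divide_left_mono) auto
  then have w: "cmod w \<le> cmod z" by (simp add: w_def norm_divide norm_power)
  have "cmod (exp w - (\<Sum>k\<le>1. w ^ k / fact k)) \<le> exp \<bar>Re w\<bar> * cmod w ^ Suc 1 / fact 1"
    by (rule Taylor_exp)
  then have "cmod (exp w - (1 + w)) \<le> exp \<bar>Re w\<bar> * (cmod w)\<^sup>2"
    by (simp add: power2_eq_square)
  also have "\<dots> \<le> exp (cmod z) * (cmod w)\<^sup>2"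
    using abs_Re_le_cmod[of w] w by (intro mult_right_mono) auto
  also have "\<dots> = exp (cmod z) * (cmod z)\<^sup>2 / n ^ 4"
    by (simp add: w_def norm_divide norm_power power_divide flip: power_mult)
  finally show ?thesis by (simp add: w_def)
qed

section \<open>Characteristic functions of normal laws, and passage from a logarithm to a nearby
  variable\<close>

section \<open>Normal laws and convergence in distribution\<close>

lemma real_distribution_normal_law:
  assumes "0 \<le> v" shows "real_distribution (normal_law m v)"
proof (cases "v = 0")
  case True
  interpret prob_space "return borel m" by (rule prob_space_return) simp
  show ?thesis using True
    by (simp add: normal_law_def real_distribution_def real_distribution_axioms_def prob_space_axioms)
next
  case False
  then show ?thesis using prob_space_normal_density[of "sqrt v" m] assms
    by (simp add: normal_law_def real_distribution_def real_distribution_axioms_def)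
qed

text \<open>A point mass for \<open>v = 0\<close>; otherwise the affine substitution
  \<open>m + \<sigma> * x\<close> reduces to the standard normal law.\<close>

lemma char_normal_law:
  assumes "0 \<le> v"
  shows "char (normal_law m v) t = exp (\<i> * (t * m) - v * t\<^sup>2 / 2)"
proof (cases "v = 0")
  case True
  then show ?thesis by (simp add: normal_law_def char_def integral_return)
next
  case False
  define \<sigma> where "\<sigma> = sqrt v"
  have \<sigma>: "\<sigma> > 0" "\<sigma>\<^sup>2 = v" using assms False by (auto simp: \<sigma>_def)
  have "char (normal_law m v) t = (CLINT x|lborel. normal_density m \<sigma> x *\<^sub>R iexp (t * x))"
    using False by (simp add: normal_law_def char_def integral_density \<sigma>_def)
  also have "\<dots> = \<sigma> *\<^sub>R (CLINT x|lborel. normal_density m \<sigma> (m + \<sigma> * x) *\<^sub>R iexp (t * (m + \<sigma> * x)))"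
    using \<sigma> by (subst lborel_integral_real_affine[where c = \<sigma> and t = m]) auto
  also have "\<dots> = (CLINT x|lborel. iexp (t * m) * (std_normal_density x *\<^sub>R iexp (\<sigma> * t * x)))"
  proof (subst integral_scaleR_right[symmetric], rule Bochner_Integration.integral_cong[OF refl])
    fix x
    have "\<sigma> * normal_density m \<sigma> (m + \<sigma> * x) = std_normal_density x"
      using \<sigma>(1) by (simp add: normal_density_def power_mult_distrib real_sqrt_mult)
    then show "\<sigma> *\<^sub>R normal_density m \<sigma> (m + \<sigma> * x) *\<^sub>R iexp (t * (m + \<sigma> * x))
        = iexp (t * m) * (std_normal_density x *\<^sub>R iexp (\<sigma> * t * x))"
      by (simp add: exp_add[symmetric] algebra_simps)
  qed
  also have "\<dots> = iexp (t * m) * char std_normal_distribution (\<sigma> * t)"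
    by (subst integral_mult_right_zero) (simp add: char_def integral_density)
  also have "\<dots> = exp (\<i> * (t * m) - v * t\<^sup>2 / 2)"
    using \<sigma>(2) by (simp add: char_std_normal_distribution exp_of_real[symmetric] exp_add[symmetric]
      power_mult_distrib flip: of_real_power)
  finally show ?thesis .
qed

text \<open>A monotone function has only countably many discontinuities, so the left interval
  provided by continuity at \<open>x\<close> contains a continuity point. Weak convergence gives
  information at such points only.\<close>

lemma cdf_continuity_point_left:
  assumes "real_distribution N" "isCont (cdf N) x" "a < cdf N x"
  obtains y where "y < x" "isCont (cdf N) y" "a < cdf N y"
proof -
  interpret real_distribution N by fact
  have "eventually (\<lambda>y. a < cdf N y) (at_left x)"
    using assms(2,3) unfolding isCont_def
    by (metis order_tendstoD(1) filterlim_at_split)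
  then obtain b where b: "b < x" "\<And>y. b < y \<Longrightarrow> y < x \<Longrightarrow> a < cdf N y"
    by (auto simp: eventually_at_left_field)
  have "mono (cdf N)" by (auto intro: monoI cdf_nondecreasing)
  from real_interval_avoid_countable_set[OF b(1) mono_ctble_discont[OF this]] b that
  show thesis by auto
qed

lemma cdf_continuity_point_right:
  assumes "real_distribution N" "isCont (cdf N) x" "cdf N x < a"
  obtains y where "x < y" "isCont (cdf N) y" "cdf N y < a"
proof -
  interpret real_distribution N by fact
  have "eventually (\<lambda>y. cdf N y < a) (at_right x)"
    using assms(2,3) unfolding isCont_def
    by (metis order_tendstoD(2) filterlim_at_split)
  then obtain b where b: "x < b" "\<And>y. x < y \<Longrightarrow> y < b \<Longrightarrow> cdf N y < a"
    by (auto simp: eventually_at_right_field)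
  have "mono (cdf N)" by (auto intro: monoI cdf_nondecreasing)
  from real_interval_avoid_countable_set[OF b(1) mono_ctble_discont[OF this]] b that
  show thesis by auto
qed

text \<open>A Slutsky argument on the exponential scale, which avoids the logarithm of
  \<open>Z n\<close>, a variable that may vanish. The distribution function is squeezed between
  those of \<open>L n\<close> at continuity points on either side of \<open>x\<close>.\<close>

lemma tendsto_cdf_exp_perturbation:
  fixes M :: "nat \<Rightarrow> 'a measure" and L Z :: "nat \<Rightarrow> 'a \<Rightarrow> real"
  assumes prob: "\<And>n. prob_space (M n)"
    and [measurable]: "\<And>n. L n \<in> borel_measurable (M n)" "\<And>n. Z n \<in> borel_measurable (M n)"
    and N: "real_distribution N"
    and conv: "weak_conv_m (\<lambda>n. distr (M n) borel (L n)) N"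
    and close: "\<And>\<delta>. 0 < \<delta> \<Longrightarrow>
      (\<lambda>n. measure (M n) {\<xi> \<in> space (M n). \<delta> \<le> \<bar>Z n \<xi> - exp (L n \<xi>)\<bar>}) \<longlonglongrightarrow> 0"
    and cont: "isCont (cdf N) x"
  shows "(\<lambda>n. measure (M n) {\<xi> \<in> space (M n). Z n \<xi> \<le> exp x}) \<longlonglongrightarrow> cdf N x"
proof -
  let ?p = "\<lambda>n. measure (M n) {\<xi> \<in> space (M n). Z n \<xi> \<le> exp x}"
    and ?q = "\<lambda>n \<delta>. measure (M n) {\<xi> \<in> space (M n). \<delta> \<le> \<bar>Z n \<xi> - exp (L n \<xi>)\<bar>}"
    and ?F = "\<lambda>n y. measure (M n) {\<xi> \<in> space (M n). L n \<xi> \<le> y}"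
  interpret M: prob_space "M n" for n by (rule prob)
  have F: "(\<lambda>n. ?F n y) \<longlonglongrightarrow> cdf N y" if "isCont (cdf N) y" for y
  proof -
    have "cdf (distr (M n) borel (L n)) y = ?F n y" for n
      by (simp add: cdf_def measure_distr vimage_def Int_def conj_commute)
    then have "(\<lambda>n. cdf (distr (M n) borel (L n)) y) = (\<lambda>n. ?F n y)" by (rule ext)
    with conv that show ?thesis unfolding weak_conv_m_def weak_conv_def by metis
  qed
  show ?thesis
  proof (rule order_tendstoI)
    fix a assume "a < cdf N x"
    then obtain y where y: "y < x" "isCont (cdf N) y" "a < cdf N y"
      using cdf_continuity_point_left[OF N cont] by blast
    \<comment> \<open>The gap on the exponential scale: if \<open>L n \<xi> \<le> y\<close>, an
      error below \<open>\<delta>\<close> cannot push \<open>Z n \<xi>\<close> above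
      \<open>exp x\<close>.\<close>
    define \<delta> where "\<delta> = exp x - exp y"
    have \<delta>: "0 < \<delta>" using y by (simp add: \<delta>_def)
    have le: "?F n y - ?q n \<delta> \<le> ?p n" for n
    proof -
      have "?F n y \<le> measure (M n) ({\<xi> \<in> space (M n). Z n \<xi> \<le> exp x}
          \<union> {\<xi> \<in> space (M n). \<delta> \<le> \<bar>Z n \<xi> - exp (L n \<xi>)\<bar>})"
      proof (rule M.finite_measure_mono)
        have "Z n \<xi> \<le> exp x" if "L n \<xi> \<le> y" "\<bar>Z n \<xi> - exp (L n \<xi>)\<bar> < \<delta>" for \<xi>
        proof -
          have "exp (L n \<xi>) \<le> exp y" using that by simp
          then show ?thesis using that(2) unfolding \<delta>_def by linarith
        qed
        then show "{\<xi> \<in> space (M n). L n \<xi> \<le> y} \<subseteq> {\<xi> \<in> space (M n). Z n \<xi> \<le> exp x}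
          \<union> {\<xi> \<in> space (M n). \<delta> \<le> \<bar>Z n \<xi> - exp (L n \<xi>)\<bar>}" by force
      qed measurable
      also have "\<dots> \<le> ?p n + ?q n \<delta>" by (rule measure_Un_le) measurable
      finally show ?thesis by simp
    qed
    have "(\<lambda>n. ?F n y - ?q n \<delta>) \<longlonglongrightarrow> cdf N y - 0"
      by (intro tendsto_diff F y close \<delta>)
    then have "eventually (\<lambda>n. a < ?F n y - ?q n \<delta>) sequentially"
      using y(3) by (intro order_tendstoD(1)) auto
    then show "eventually (\<lambda>n. a < ?p n) sequentially"
      by eventually_elim (use le less_le_trans in blast)
  next
    fix a assume "cdf N x < a"
    then obtain y where y: "x < y" "isCont (cdf N) y" "cdf N y < a"
      using cdf_continuity_point_right[OF N cont] by blast
    define \<delta> where "\<delta> = exp y - exp x"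
    have \<delta>: "0 < \<delta>" using y by (simp add: \<delta>_def)
    have le: "?p n \<le> ?F n y + ?q n \<delta>" for n
    proof -
      have "?p n \<le> measure (M n) ({\<xi> \<in> space (M n). L n \<xi> \<le> y}
          \<union> {\<xi> \<in> space (M n). \<delta> \<le> \<bar>Z n \<xi> - exp (L n \<xi>)\<bar>})"
      proof (rule M.finite_measure_mono)
        have "L n \<xi> \<le> y" if "Z n \<xi> \<le> exp x" "\<bar>Z n \<xi> - exp (L n \<xi>)\<bar> < \<delta>" for \<xi>
        proof -
          have "exp (L n \<xi>) < exp y" using that unfolding \<delta>_def by linarith
          then show ?thesis by simp
        qed
        then show "{\<xi> \<in> space (M n). Z n \<xi> \<le> exp x} \<subseteq> {\<xi> \<in> space (M n). L n \<xi> \<le> y}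
          \<union> {\<xi> \<in> space (M n). \<delta> \<le> \<bar>Z n \<xi> - exp (L n \<xi>)\<bar>}" by force
      qed measurable
      also have "\<dots> \<le> ?F n y + ?q n \<delta>" by (rule measure_Un_le) measurable
      finally show ?thesis .
    qed
    have "(\<lambda>n. ?F n y + ?q n \<delta>) \<longlonglongrightarrow> cdf N y + 0"
      by (intro tendsto_add F y close \<delta>)
    then have "eventually (\<lambda>n. ?F n y + ?q n \<delta> < a) sequentially"
      using y(3) by (intro order_tendstoD(2)) auto
    then show "eventually (\<lambda>n. ?p n < a) sequentially"
      by eventually_elim (use le le_less_trans in blast)
  qed
qed

section \<open>Second moments of the permanent, the product and their difference\<close>

section \<open>Mean square comparison of the permanent with a product\<close>

text \<open>Functions of independent variables remain independent. The factor may depend on the edge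
  and may be complex, so that one statement covers real moments and characteristic
  functions.\<close>

lemma (in prob_space)
  fixes f :: "'i \<Rightarrow> real \<Rightarrow> 'c :: {real_normed_field, banach, second_countable_topology}"
  assumes E: "finite E" and indep: "indep_vars (\<lambda>_. borel) X E"
    and law: "\<And>e. e \<in> E \<Longrightarrow> distr M borel (X e) = \<nu>"
    and int: "\<And>e. e \<in> E \<Longrightarrow> integrable \<nu> (f e)"
  shows integrable_prod_iid: "integrable M (\<lambda>\<xi>. \<Prod>e\<in>E. f e (X e \<xi>))"
    and expectation_prod_iid: "(\<integral>\<xi>. (\<Prod>e\<in>E. f e (X e \<xi>)) \<partial>M) = (\<Prod>e\<in>E. \<integral>x. f e x \<partial>\<nu>)"
proof -
  have X: "X e \<in> borel_measurable M" if "e \<in> E" for e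
    using indep that unfolding indep_vars_def by auto
  have f: "f e \<in> borel_measurable borel" if "e \<in> E" for e
    using int[OF that] law[OF that] by (metis borel_measurable_integrable measurable_distr_eq1)
  have indep_f: "indep_vars (\<lambda>_. borel) (\<lambda>e \<xi>. f e (X e \<xi>)) E"
    using f by (intro indep_vars_compose2[OF indep])
  have int_f: "integrable M (\<lambda>\<xi>. f e (X e \<xi>))" if "e \<in> E" for e
    using integrable_distr_eq[OF X[OF that] f[OF that]] int[OF that] law[OF that] by simp
  show "integrable M (\<lambda>\<xi>. \<Prod>e\<in>E. f e (X e \<xi>))"
    by (rule indep_vars_integrable[OF E indep_f int_f])
  have "(\<integral>\<xi>. (\<Prod>e\<in>E. f e (X e \<xi>)) \<partial>M) = (\<Prod>e\<in>E. \<integral>\<xi>. f e (X e \<xi>) \<partial>M)"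
    by (rule indep_vars_lebesgue_integral[OF E indep_f int_f])
  also have "\<dots> = (\<Prod>e\<in>E. \<integral>x. f e x \<partial>\<nu>)"
    using integral_distr[OF X f] law by (intro prod.cong) auto
  finally show "(\<integral>\<xi>. (\<Prod>e\<in>E. f e (X e \<xi>)) \<partial>M) = (\<Prod>e\<in>E. \<integral>x. f e x \<partial>\<nu>)" .
qed

definition normalized_permanent :: "nat \<Rightarrow> (nat \<times> nat \<Rightarrow> real) \<Rightarrow> real" where
  "normalized_permanent n x = (\<Sum>\<pi>\<in>perfect_matchings n. \<Prod>e\<in>\<pi>. x e) / fact n"

text \<open>The factor \<open>1 / n\<close> is the probability that a given edge lies in a uniform
  perfect matching. Expanded in the centred weights, this product and the normalized permanent have
  the same constant and linear terms.\<close>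

definition edge_product :: "nat \<Rightarrow> (nat \<times> nat \<Rightarrow> real) \<Rightarrow> real" where
  "edge_product n x = (\<Prod>e\<in>Knn_edges n. 1 + (x e - 1) / n)"

lemma finite_Knn_edges: "finite (Knn_edges n)"
  by (simp add: Knn_edges_def)

lemma finite_perfect_matchings: "finite (perfect_matchings n)"
  unfolding perfect_matchings_eq by (intro finite_matchings_between) simp_all

lemma card_perfect_matchings: "card (perfect_matchings n) = fact n"
  unfolding perfect_matchings_eq by (subst card_matchings_between) simp_all

lemma perfect_matching_subset: "\<pi> \<in> perfect_matchings n \<Longrightarrow> \<pi> \<subseteq> Knn_edges n"
  by (simp add: perfect_matchings_def)

lemma card_perfect_matching: "\<pi> \<in> perfect_matchings n \<Longrightarrow> card \<pi> = n"
  unfolding perfect_matchings_eq using card_matching by fastforce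

text \<open>Padding with ones puts products over different edge sets on the common index set
  \<open>E\<close>, where they multiply edge by edge.\<close>

lemma prod_subset_eq_prod_if:
  fixes f :: "'a \<Rightarrow> 'b :: comm_monoid_mult"
  assumes "finite E" "S \<subseteq> E"
  shows "(\<Prod>e\<in>S. f e) = (\<Prod>e\<in>E. if e \<in> S then f e else 1)"
proof -
  have "E \<inter> S = S" using assms by auto
  then show ?thesis using prod.inter_restrict[OF assms(1), of f S] by simp
qed

text \<open>Expand the square. Each product that arises factors over the edges, so independence
  reduces its mean to one-edge means. The cross term and the square of the edge product are computed
  exactly; the square of the permanent is bounded through the overlaps.\<close>

lemma (in prob_space)
  fixes X :: "nat \<times> nat \<Rightarrow> 'a \<Rightarrow> real"
  assumes \<nu>: "prob_space \<nu>" and n: "0 < n"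
    and indep: "indep_vars (\<lambda>_. borel) X (Knn_edges n)"
    and law: "\<And>e. e \<in> Knn_edges n \<Longrightarrow> distr M borel (X e) = \<nu>"
    and int1[simp]: "integrable \<nu> (\<lambda>x. x)" and mean[simp]: "(\<integral>x. x \<partial>\<nu>) = 1"
    and int2[simp]: "integrable \<nu> (\<lambda>x. x\<^sup>2)" and second[simp]: "(\<integral>x. x\<^sup>2 \<partial>\<nu>) = 1 + s"
    and s: "0 \<le> s"
  shows integrable_permanent_diff: "integrable M (\<lambda>\<xi>.
      (normalized_permanent n (\<lambda>e. X e \<xi>) - edge_product n (\<lambda>e. X e \<xi>))\<^sup>2)"
    and expectation_permanent_diff_le: "(\<integral>\<xi>.
      (normalized_permanent n (\<lambda>e. X e \<xi>) - edge_product n (\<lambda>e. X e \<xi>))\<^sup>2 \<partial>M)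
      \<le> exp s - 2 * (1 + s / n) ^ n + (1 + s / n\<^sup>2) ^ n\<^sup>2"
proof -
  interpret \<nu>: prob_space \<nu> by (rule \<nu>)
  define E PM where "E = Knn_edges n" and "PM = perfect_matchings n"
  define m where "m = (\<lambda>\<pi> \<xi>. \<Prod>e\<in>\<pi>. X e \<xi>)"
  define P where "P = (\<lambda>\<xi>. edge_product n (\<lambda>e. X e \<xi>))"
  define Z where "Z = (\<lambda>\<xi>. normalized_permanent n (\<lambda>e. X e \<xi>))"
  have finE: "finite E" and cardE: "card E = n\<^sup>2" and finPM: "finite PM" and cardPM: "card PM = fact n"
    by (simp_all add: E_def PM_def finite_Knn_edges finite_perfect_matchings card_perfect_matchings
      Knn_edges_def power2_eq_square)
  have sub: "\<pi> \<subseteq> E" if "\<pi> \<in> PM" for \<pi>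
    using that perfect_matching_subset by (simp add: E_def PM_def)
  note iid = finE indep[folded E_def] law[folded E_def]
  note integrable = integrable_prod_iid[OF iid] and expectation = expectation_prod_iid[OF iid]

  have mm: "integrable M (\<lambda>\<xi>. m \<pi> \<xi> * m \<sigma> \<xi>)"
      "(\<integral>\<xi>. m \<pi> \<xi> * m \<sigma> \<xi> \<partial>M) = (1 + s) ^ card (\<pi> \<inter> \<sigma>)"
    if \<pi>: "\<pi> \<in> PM" and \<sigma>: "\<sigma> \<in> PM" for \<pi> \<sigma>
  proof -
    \<comment> \<open>A common edge contributes a square, of mean \<open>1 + s\<close>; every other
      edge contributes a factor of mean 1.\<close>
    define f :: "nat \<times> nat \<Rightarrow> real \<Rightarrow> real" where
      "f = (\<lambda>e x. if e \<in> \<pi> \<inter> \<sigma> then x\<^sup>2 else if e \<in> \<pi> \<union> \<sigma> then x else 1)"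
    have eq: "m \<pi> \<xi> * m \<sigma> \<xi> = (\<Prod>e\<in>E. f e (X e \<xi>))" for \<xi>
      unfolding m_def prod_subset_eq_prod_if[OF finE sub[OF \<pi>]] prod_subset_eq_prod_if[OF finE sub[OF \<sigma>]]
        prod.distrib[symmetric]
      by (intro prod.cong) (auto simp: f_def power2_eq_square)
    have int: "integrable \<nu> (f e)" for e
      by (cases "e \<in> \<pi>"; cases "e \<in> \<sigma>") (simp_all add: f_def)
    have "(\<Prod>e\<in>E. \<integral>x. f e x \<partial>\<nu>) = (\<Prod>e\<in>E. if e \<in> \<pi> \<inter> \<sigma> then 1 + s else 1)"
    proof (rule prod.cong[OF refl])
      fix e
      show "(\<integral>x. f e x \<partial>\<nu>) = (if e \<in> \<pi> \<inter> \<sigma> then 1 + s else 1)"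
        by (cases "e \<in> \<pi>"; cases "e \<in> \<sigma>") (simp_all add: f_def \<nu>.prob_space)
    qed
    also have "\<dots> = (1 + s) ^ card (\<pi> \<inter> \<sigma>)"
      using prod_subset_eq_prod_if[OF finE le_infI1[OF sub[OF \<pi>]], of "\<lambda>_. 1 + s" \<sigma>] by simp
    finally show "(\<integral>\<xi>. m \<pi> \<xi> * m \<sigma> \<xi> \<partial>M) = (1 + s) ^ card (\<pi> \<inter> \<sigma>)"
      unfolding eq by (simp add: expectation int)
    show "integrable M (\<lambda>\<xi>. m \<pi> \<xi> * m \<sigma> \<xi>)"
      unfolding eq by (rule integrable) (simp_all add: int)
  qed

  have int_lin[simp]: "integrable \<nu> (\<lambda>x. 1 + (x - 1) / real n)"
    by simp
  \<comment> \<open>Rewritten in powers of \<open>x\<close> to use the uncentred moments;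
    \<open>E[x (x - 1)] = s\<close> yields the mean \<open>1 + s / n\<close>.\<close>
  have lin: "x * (1 + (x - 1) / n) = (1 - 1 / n) * x + x\<^sup>2 / n" for x :: real
    using n by (simp add: field_simps power2_eq_square)
  have int_cross: "integrable \<nu> (\<lambda>x. x * (1 + (x - 1) / n))"
    unfolding lin by simp
  have mean_cross: "(\<integral>x. x * (1 + (x - 1) / n) \<partial>\<nu>) = 1 + s / n"
    unfolding lin using n by (simp add: field_simps)
  have mean_lin: "(\<integral>x. 1 + (x - 1) / real n \<partial>\<nu>) = 1"
    by (simp add: \<nu>.prob_space)
  have sq: "(1 + (x - 1) / n)\<^sup>2 = (1 - 1 / n)\<^sup>2 + 2 * (1 - 1 / n) / n * x + x\<^sup>2 / n\<^sup>2" for x :: real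
    using n by (simp add: field_simps power2_eq_square)
  have int_sq: "integrable \<nu> (\<lambda>x. (1 + (x - 1) / n)\<^sup>2)"
    unfolding sq by simp
  have mean_sq: "(\<integral>x. (1 + (x - 1) / n)\<^sup>2 \<partial>\<nu>) = 1 + s / n\<^sup>2"
  proof -
    have "(\<integral>x. (1 + (x - 1) / n)\<^sup>2 \<partial>\<nu>) = (1 - 1 / n)\<^sup>2 + 2 * (1 - 1 / n) / n + (1 + s) / n\<^sup>2"
      unfolding sq by (simp add: \<nu>.prob_space)
    also have "\<dots> = 1 + s / n\<^sup>2" using n by (simp add: field_simps power2_eq_square)
    finally show ?thesis .
  qed

  have mP: "integrable M (\<lambda>\<xi>. m \<pi> \<xi> * P \<xi>)" "(\<integral>\<xi>. m \<pi> \<xi> * P \<xi> \<partial>M) = (1 + s / n) ^ n"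
    if \<pi>: "\<pi> \<in> PM" for \<pi>
  proof -
    define f :: "nat \<times> nat \<Rightarrow> real \<Rightarrow> real" where
      "f = (\<lambda>e x. if e \<in> \<pi> then x * (1 + (x - 1) / n) else 1 + (x - 1) / n)"
    have eq: "m \<pi> \<xi> * P \<xi> = (\<Prod>e\<in>E. f e (X e \<xi>))" for \<xi>
      unfolding m_def P_def edge_product_def prod_subset_eq_prod_if[OF finE sub[OF \<pi>]]
        E_def[symmetric] prod.distrib[symmetric]
      by (intro prod.cong) (auto simp: f_def)
    have int: "integrable \<nu> (f e)" for e
      using int_cross by (cases "e \<in> \<pi>") (simp_all add: f_def)
    have "(\<Prod>e\<in>E. \<integral>x. f e x \<partial>\<nu>) = (\<Prod>e\<in>E. if e \<in> \<pi> then 1 + s / n else 1)"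
    proof (rule prod.cong[OF refl])
      fix e
      show "(\<integral>x. f e x \<partial>\<nu>) = (if e \<in> \<pi> then 1 + s / n else 1)"
        using mean_cross mean_lin by (cases "e \<in> \<pi>") (simp_all only: f_def if_True if_False)
    qed
    also have "\<dots> = (1 + s / n) ^ n"
      using prod_subset_eq_prod_if[OF finE sub[OF \<pi>], of "\<lambda>_. 1 + s / n"]
        card_perfect_matching[of \<pi> n] \<pi> by (simp add: PM_def)
    finally show "(\<integral>\<xi>. m \<pi> \<xi> * P \<xi> \<partial>M) = (1 + s / n) ^ n"
      unfolding eq by (simp add: expectation int)
    show "integrable M (\<lambda>\<xi>. m \<pi> \<xi> * P \<xi>)"
      unfolding eq by (rule integrable) (simp_all add: int)
  qed

  have eqPP: "(P \<xi>)\<^sup>2 = (\<Prod>e\<in>E. (1 + (X e \<xi> - 1) / n)\<^sup>2)" for \<xi>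
    by (simp add: P_def edge_product_def E_def prod_power_distrib)
  have PP: "integrable M (\<lambda>\<xi>. (P \<xi>)\<^sup>2)" "(\<integral>\<xi>. (P \<xi>)\<^sup>2 \<partial>M) = (1 + s / n\<^sup>2) ^ n\<^sup>2"
    unfolding eqPP
    using integrable[of "\<lambda>_ x. (1 + (x - 1) / n)\<^sup>2"] expectation[of "\<lambda>_ x. (1 + (x - 1) / n)\<^sup>2"]
      int_sq mean_sq cardE by simp_all

  have Z: "Z \<xi> = (\<Sum>\<pi>\<in>PM. m \<pi> \<xi>) / fact n" for \<xi>
    by (simp add: Z_def normalized_permanent_def PM_def m_def)
  have eqZZ: "(Z \<xi>)\<^sup>2 = (\<Sum>\<pi>\<in>PM. \<Sum>\<sigma>\<in>PM. m \<pi> \<xi> * m \<sigma> \<xi>) / (fact n)\<^sup>2" for \<xi>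
    by (simp add: Z power_divide power2_eq_square[of "sum _ _"] sum_product)
  have eqZP: "Z \<xi> * P \<xi> = (\<Sum>\<pi>\<in>PM. m \<pi> \<xi> * P \<xi>) / fact n" for \<xi>
    by (simp add: Z sum_distrib_right)
  have intZZ: "integrable M (\<lambda>\<xi>. (Z \<xi>)\<^sup>2)" and intZP: "integrable M (\<lambda>\<xi>. Z \<xi> * P \<xi>)"
    unfolding eqZZ eqZP using mm(1) mP(1)
    by (auto intro!: integrable_divide Bochner_Integration.integrable_sum)
  have "(\<integral>\<xi>. (Z \<xi>)\<^sup>2 \<partial>M) = (\<Sum>\<pi>\<in>PM. \<Sum>\<sigma>\<in>PM. (1 + s) ^ card (\<pi> \<inter> \<sigma>)) / (fact n)\<^sup>2"
    unfolding eqZZ using mm by (simp add: Bochner_Integration.integral_sum)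
  \<comment> \<open>The overlap bound is the same for each \<open>\<pi>\<close>, and the
    \<open>n!\<close> choices of \<open>\<pi>\<close> cancel the remaining normalization.\<close>
  also have "\<dots> \<le> (\<Sum>\<pi>\<in>PM. fact n * exp s) / (fact n)\<^sup>2"
  proof (intro divide_right_mono sum_mono)
    fix \<pi> assume "\<pi> \<in> PM"
    then show "(\<Sum>\<sigma>\<in>PM. (1 + s) ^ card (\<pi> \<inter> \<sigma>)) \<le> fact n * exp s"
      using sum_power_overlap_le[of "{..<n}" "{..<n}" \<pi> s] s by (simp add: PM_def perfect_matchings_eq)
  qed simp
  also have "\<dots> = exp s"
    by (simp add: cardPM power2_eq_square)
  finally have ZZ: "(\<integral>\<xi>. (Z \<xi>)\<^sup>2 \<partial>M) \<le> exp s" .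
  have ZP: "(\<integral>\<xi>. Z \<xi> * P \<xi> \<partial>M) = (1 + s / n) ^ n"
    unfolding eqZP using mP by (simp add: Bochner_Integration.integral_sum cardPM)
  have eq: "(Z \<xi> - P \<xi>)\<^sup>2 = (Z \<xi>)\<^sup>2 - 2 * (Z \<xi> * P \<xi>) + (P \<xi>)\<^sup>2" for \<xi>
    by (simp add: power2_diff)
  have "integrable M (\<lambda>\<xi>. (Z \<xi> - P \<xi>)\<^sup>2)"
    unfolding eq using intZZ intZP PP(1) by simp
  then show "integrable M (\<lambda>\<xi>.
      (normalized_permanent n (\<lambda>e. X e \<xi>) - edge_product n (\<lambda>e. X e \<xi>))\<^sup>2)"
    by (simp add: Z_def P_def)
  have "(\<integral>\<xi>. (Z \<xi> - P \<xi>)\<^sup>2 \<partial>M) \<le> exp s - 2 * (1 + s / n) ^ n + (1 + s / n\<^sup>2) ^ n\<^sup>2"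
    unfolding eq using intZZ intZP PP ZZ ZP by simp
  then show "(\<integral>\<xi>. (normalized_permanent n (\<lambda>e. X e \<xi>) - edge_product n (\<lambda>e. X e \<xi>))\<^sup>2 \<partial>M)
      \<le> exp s - 2 * (1 + s / n) ^ n + (1 + s / n\<^sup>2) ^ n\<^sup>2"
    by (simp add: Z_def P_def)
qed

section \<open>Central limit theorem for the product and its transfer to the permanent\<close>

section \<open>Limit laws\<close>

text \<open>The third absolute moment makes the one-edge error \<open>O(n^-3)\<close>, so the
  \<open>n^2\<close> independent factors accumulate an error of only \<open>O(1 / n)\<close>.
  Nonnegativity keeps the argument of \<open>ln\<close> at least 1/2 once
  \<open>n \<ge> 2\<close>.\<close>

lemma weak_conv_log_edge_product:
  fixes M :: "nat \<Rightarrow> 'a measure" and X :: "nat \<Rightarrow> nat \<times> nat \<Rightarrow> 'a \<Rightarrow> real"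
  assumes prob: "\<And>n. prob_space (M n)" and \<nu>: "prob_space \<nu>"
    and indep: "\<And>n. prob_space.indep_vars (M n) (\<lambda>_. borel) (X n) (Knn_edges n)"
    and law: "\<And>n e. e \<in> Knn_edges n \<Longrightarrow> distr (M n) borel (X n e) = \<nu>"
    and nonneg: "AE x in \<nu>. 0 \<le> x"
    and int1: "integrable \<nu> (\<lambda>x. x - 1)" and mean: "(\<integral>x. x - 1 \<partial>\<nu>) = 0"
    and int2: "integrable \<nu> (\<lambda>x. (x - 1)\<^sup>2)" and second: "(\<integral>x. (x - 1)\<^sup>2 \<partial>\<nu>) = s"
    and int3: "integrable \<nu> (\<lambda>x. \<bar>x - 1\<bar> ^ 3)"
  shows "weak_conv_m (\<lambda>n. distr (M n) borel (\<lambda>\<xi>. \<Sum>e\<in>Knn_edges n. ln (1 + (X n e \<xi> - 1) / n)))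
    (normal_law (- s / 2) s)"
proof -
  interpret \<nu>: prob_space \<nu> by (rule \<nu>)
  have s: "0 \<le> s" unfolding second[symmetric] by (rule integral_nonneg_AE) simp
  \<comment> \<open>The smallest graph with an edge has \<open>n = 1\<close>; its edge identifies
    the sigma-algebra of \<open>\<nu>\<close>.\<close>
  have "distr (M 1) borel (X 1 (0, 0)) = \<nu>" by (rule law) (simp add: Knn_edges_def)
  then have sets[measurable_cong]: "sets \<nu> = sets borel" by (metis sets_distr)
  let ?L = "\<lambda>n \<xi>. \<Sum>e\<in>Knn_edges n. ln (1 + (X n e \<xi> - 1) / n)"
  have X: "X n e \<in> borel_measurable (M n)" if "e \<in> Knn_edges n" for n e
    using indep[of n] that unfolding prob_space.indep_vars_def[OF prob] by auto
  have L: "?L n \<in> borel_measurable (M n)" for n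
    using X by (intro borel_measurable_sum) (auto intro!: borel_measurable_ln)
  show ?thesis
  proof (rule levy_continuity)
    show "real_distribution (distr (M n) borel (?L n))" for n
      using prob_space.real_distribution_distr[OF prob L] .
    show "real_distribution (normal_law (- s / 2) s)"
      using s by (rule real_distribution_normal_law)
    fix t :: real
    \<comment> \<open>The exponent of the limiting characteristic function at
      \<open>t\<close>.\<close>
    define z where "z = - ((\<i> * t + t\<^sup>2) / 2 * s)"
    define C where "C = 2 * \<bar>t\<bar> ^ 3 + \<bar>t\<bar> + 2 * t\<^sup>2"
    define K where "K = (\<integral>x. \<bar>x - 1\<bar> ^ 3 \<partial>\<nu>)"
    define \<phi> where "\<phi> = (\<lambda>n::nat. CLINT x|\<nu>. iexp (t * ln (1 + (x - 1) / n)))"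
    have Re_z: "Re z \<le> 0" using s by (simp add: z_def)
    have int_iexp: "integrable \<nu> (\<lambda>x. iexp (t * ln (1 + (x - 1) / real n)))" for n
      by (rule \<nu>.integrable_const_bound[of _ 1]) auto
    have norm_\<phi>: "cmod (\<phi> n) \<le> 1" for n
    proof -
      have "cmod (\<phi> n) \<le> (\<integral>x. cmod (iexp (t * ln (1 + (x - 1) / real n))) \<partial>\<nu>)"
        unfolding \<phi>_def by (rule integral_norm_bound)
      then show ?thesis by (simp add: \<nu>.prob_space)
    qed
    have char: "char (distr (M n) borel (?L n)) t = \<phi> n ^ n\<^sup>2" for n
    proof -
      interpret M: prob_space "M n" by (rule prob)
      have "char (distr (M n) borel (?L n)) t = (CLINT \<xi>|M n. iexp (t * ?L n \<xi>))"
        unfolding char_def by (rule integral_distr[OF L]) measurable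
      also have "\<dots> = (CLINT \<xi>|M n. (\<Prod>e\<in>Knn_edges n. iexp (t * ln (1 + (X n e \<xi> - 1) / n))))"
        by (simp add: sum_distrib_left exp_sum finite_Knn_edges)
      also have "\<dots> = (\<Prod>e\<in>Knn_edges n. \<phi> n)"
        unfolding \<phi>_def
        using M.expectation_prod_iid[OF finite_Knn_edges indep law, where f = "\<lambda>_ x. iexp (t * ln (1 + (x - 1) / n))"]
          int_iexp by simp
      also have "\<dots> = \<phi> n ^ n\<^sup>2" by (simp add: Knn_edges_def power2_eq_square)
      finally show ?thesis .
    qed
    have \<phi>_approx: "cmod (\<phi> n - (1 + z / n\<^sup>2)) \<le> C * K / n ^ 3" if n: "2 \<le> n" for n :: nat
    proof -
      \<comment> \<open>The quadratic expansion at \<open>y = (x - 1) / n\<close>. The linear term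
        has mean 0, so the mean of \<open>q\<close> is exactly \<open>1 + z / n^2\<close>.\<close>
      define q where "q = (\<lambda>x::real. 1 + \<i> * t / n * (x - 1) - (\<i> * t + t\<^sup>2) / 2 / n\<^sup>2 * ((x - 1)\<^sup>2 :: real))"
      have i1: "integrable \<nu> (\<lambda>x. complex_of_real (x - 1))"
        and i2: "integrable \<nu> (\<lambda>x. complex_of_real ((x - 1)\<^sup>2))"
        using int1 int2 by (simp_all only: integrable_of_real)
      have i1': "integrable \<nu> (\<lambda>x. 1 + \<i> * t / n * complex_of_real (x - 1))"
        by (intro Bochner_Integration.integrable_add integrable_mult_right i1) simp
      have i2': "integrable \<nu> (\<lambda>x. (\<i> * t + t\<^sup>2) / 2 / n\<^sup>2 * complex_of_real ((x - 1)\<^sup>2))"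
        by (intro integrable_mult_right i2)
      have int_q: "integrable \<nu> q"
        unfolding q_def by (rule Bochner_Integration.integrable_diff[OF i1' i2'])
      have c1: "(CLINT x|\<nu>. complex_of_real (x - 1)) = 0" using mean by (simp only: integral_complex_of_real of_real_0)
      have c2: "(CLINT x|\<nu>. complex_of_real ((x - 1)\<^sup>2)) = s" using second by (simp only: integral_complex_of_real)
      have "(CLINT x|\<nu>. q x) = (CLINT x|\<nu>. 1 + \<i> * t / n * complex_of_real (x - 1))
          - (\<i> * t + t\<^sup>2) / 2 / n\<^sup>2 * (CLINT x|\<nu>. complex_of_real ((x - 1)\<^sup>2))"
        unfolding q_def Bochner_Integration.integral_diff[OF i1' i2'] integral_mult_right_zero ..
      also have "(CLINT x|\<nu>. 1 + \<i> * t / n * complex_of_real (x - 1))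
          = 1 + \<i> * t / n * (CLINT x|\<nu>. complex_of_real (x - 1))"
        by (subst Bochner_Integration.integral_add[OF _ integrable_mult_right[OF i1]])
          (simp_all only: integral_mult_right_zero lebesgue_integral_const \<nu>.prob_space
            \<nu>.integrable_const scaleR_one)
      finally have "(CLINT x|\<nu>. q x) = 1 + \<i> * t / n * (CLINT x|\<nu>. complex_of_real (x - 1))
          - (\<i> * t + t\<^sup>2) / 2 / n\<^sup>2 * (CLINT x|\<nu>. complex_of_real ((x - 1)\<^sup>2))" .
      then have mean_q: "(CLINT x|\<nu>. q x) = 1 + z / n\<^sup>2"
        unfolding c1 c2 by (simp add: z_def)
      have "\<phi> n - (1 + z / n\<^sup>2) = (CLINT x|\<nu>. iexp (t * ln (1 + (x - 1) / n)) - q x)"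
        unfolding \<phi>_def mean_q[symmetric] by (rule Bochner_Integration.integral_diff[OF int_iexp int_q, symmetric])
      also have "cmod \<dots> \<le> (\<integral>x. cmod (iexp (t * ln (1 + (x - 1) / n)) - q x) \<partial>\<nu>)"
        by (rule integral_norm_bound)
      also have "\<dots> \<le> (\<integral>x. C / n ^ 3 * \<bar>x - 1\<bar> ^ 3 \<partial>\<nu>)"
      proof (rule integral_mono_AE)
        show "AE x in \<nu>. cmod (iexp (t * ln (1 + (x - 1) / n)) - q x) \<le> C / n ^ 3 * \<bar>x - 1\<bar> ^ 3"
          using nonneg
        proof eventually_elim
          fix x :: real assume "0 \<le> x"
          define y where "y = (x - 1) / n"
          have "- (1 / 2) \<le> - 1 / real n" using n by (simp add: field_simps)
          also have "\<dots> \<le> y" using \<open>0 \<le> x\<close> unfolding y_def by (intro divide_right_mono) auto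
          finally have "cmod (iexp (t * ln (1 + y)) - (1 + \<i> * t * y - (\<i> * t + t\<^sup>2) / 2 * y\<^sup>2)) \<le> C * \<bar>y\<bar> ^ 3"
            unfolding C_def by (intro iexp_ln_one_plus_taylor) simp
          moreover have "1 + \<i> * t * y - (\<i> * t + t\<^sup>2) / 2 * y\<^sup>2 = q x"
            by (simp add: q_def y_def power_divide)
          moreover have "C * \<bar>y\<bar> ^ 3 = C / n ^ 3 * \<bar>x - 1\<bar> ^ 3"
            by (simp add: y_def power_divide)
          ultimately show "cmod (iexp (t * ln (1 + (x - 1) / n)) - q x) \<le> C / n ^ 3 * \<bar>x - 1\<bar> ^ 3"
            by (simp add: y_def)
        qed
      qed (use int_iexp int_q int3 in simp_all)
      also have "\<dots> = C * K / n ^ 3" by (simp add: K_def)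
      finally show ?thesis .
    qed
    \<comment> \<open>For two numbers in the closed unit disc, the difference of their
      \<open>N\<close>-th powers is at most \<open>N\<close> times their distance. It is applied
      with \<open>N = n^2\<close> to \<open>\<phi> n\<close> and \<open>exp (z / n^2)\<close>; the
      latter lies in the disc because \<open>Re z \<le> 0\<close>.\<close>
    have bound: "cmod (\<phi> n ^ n\<^sup>2 - exp z) \<le> C * K / n + exp (cmod z) * (cmod z)\<^sup>2 / n\<^sup>2"
      if n: "2 \<le> n" for n :: nat
    proof -
      have "exp z = exp (z / n\<^sup>2) ^ n\<^sup>2"
        using n by (simp flip: exp_of_nat_mult)
      moreover have "cmod (exp (z / n\<^sup>2)) \<le> 1"
        using Re_z by (simp add: divide_le_0_iff flip: of_nat_power)
      ultimately have "cmod (\<phi> n ^ n\<^sup>2 - exp z) \<le> n\<^sup>2 * cmod (\<phi> n - exp (z / n\<^sup>2))"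
        using norm_power_diff[OF norm_\<phi>[of n], of "exp (z / n\<^sup>2)" "n\<^sup>2"] by simp
      also have "cmod (\<phi> n - exp (z / n\<^sup>2)) \<le> C * K / n ^ 3 + exp (cmod z) * (cmod z)\<^sup>2 / n ^ 4"
        using norm_triangle_ineq4[of "\<phi> n - (1 + z / n\<^sup>2)" "exp (z / n\<^sup>2) - (1 + z / n\<^sup>2)"]
          \<phi>_approx[OF n] norm_exp_over_square_taylor_le[of n z] n by simp
      finally have "cmod (\<phi> n ^ n\<^sup>2 - exp z)
          \<le> n\<^sup>2 * (C * K / n ^ 3 + exp (cmod z) * (cmod z)\<^sup>2 / n ^ 4)"
        by (simp add: mult_left_mono)
      also have "\<dots> = C * K / n + exp (cmod z) * (cmod z)\<^sup>2 / n\<^sup>2"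
        using n by (simp add: field_simps eval_nat_numeral)
      finally show ?thesis .
    qed
    have "(\<lambda>n. \<phi> n ^ n\<^sup>2 - exp z) \<longlonglongrightarrow> 0"
    proof (rule Lim_null_comparison)
      show "eventually (\<lambda>n. cmod (\<phi> n ^ n\<^sup>2 - exp z)
          \<le> C * K / n + exp (cmod z) * (cmod z)\<^sup>2 / n\<^sup>2) sequentially"
        by (rule eventually_mono[OF eventually_ge_at_top[of 2] bound])
      show "(\<lambda>n. C * K / n + exp (cmod z) * (cmod z)\<^sup>2 / real (n\<^sup>2)) \<longlonglongrightarrow> 0"
        by real_asymp
    qed
    then have "(\<lambda>n. \<phi> n ^ n\<^sup>2) \<longlonglongrightarrow> exp z"
      by (simp add: LIM_zero_iff)
    moreover have "char (normal_law (- s / 2) s) t = exp z"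
      unfolding char_normal_law[OF s] by (rule arg_cong[where f = exp]) (simp add: z_def field_simps)
    ultimately show "(\<lambda>n. char (distr (M n) borel (?L n)) t) \<longlonglongrightarrow> char (normal_law (- s / 2) s) t"
      by (simp add: char)
  qed
qed

text \<open>Chebyshev's bound turns the mean square estimate into closeness in probability of the
  permanent to the product, and the limit law of the log product then passes to the
  permanent.\<close>

lemma tendsto_prob_normalized_permanent_le:
  fixes M :: "nat \<Rightarrow> 'a measure" and X :: "nat \<Rightarrow> nat \<times> nat \<Rightarrow> 'a \<Rightarrow> real"
  assumes prob: "\<And>n. prob_space (M n)" and \<nu>: "prob_space \<nu>"
    and indep: "\<And>n. prob_space.indep_vars (M n) (\<lambda>_. borel) (X n) (Knn_edges n)"
    and law: "\<And>n e. e \<in> Knn_edges n \<Longrightarrow> distr (M n) borel (X n e) = \<nu>"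
    and nonneg: "\<And>n e \<xi>. 0 \<le> X n e \<xi>"
    and int: "\<And>k. integrable \<nu> (\<lambda>x. x ^ k)"
    and mean: "(\<integral>x. x \<partial>\<nu>) = 1" and second: "(\<integral>x. x\<^sup>2 \<partial>\<nu>) = 1 + s"
    and cont: "isCont (cdf (normal_law (- s / 2) s)) x"
  shows "(\<lambda>n. measure (M n) {\<xi> \<in> space (M n). normalized_permanent n (\<lambda>e. X n e \<xi>) \<le> exp x})
    \<longlonglongrightarrow> cdf (normal_law (- s / 2) s) x"
proof -
  interpret \<nu>: prob_space \<nu> by (rule \<nu>)
  let ?L = "\<lambda>n \<xi>. \<Sum>e\<in>Knn_edges n. ln (1 + (X n e \<xi> - 1) / n)"
    and ?Z = "\<lambda>n \<xi>. normalized_permanent n (\<lambda>e. X n e \<xi>)"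
    and ?P = "\<lambda>n \<xi>. edge_product n (\<lambda>e. X n e \<xi>)"
  have int1: "integrable \<nu> (\<lambda>x. x)" and int2: "integrable \<nu> (\<lambda>x. x\<^sup>2)" and int3: "integrable \<nu> (\<lambda>x. x ^ 3)"
    using int[of 1] int[of 2] int[of 3] by simp_all
  have centered_sq: "(x - 1)\<^sup>2 = x\<^sup>2 - 2 * x + 1" for x :: real
    by (simp add: power2_diff)
  have int2': "integrable \<nu> (\<lambda>x. (x - 1)\<^sup>2)" and second': "(\<integral>x. (x - 1)\<^sup>2 \<partial>\<nu>) = s"
    unfolding centered_sq using int1 int2 mean second by (simp_all add: \<nu>.prob_space)
  have s: "0 \<le> s" unfolding second'[symmetric] by (rule integral_nonneg_AE) simp
  have mean': "(\<integral>x. x - 1 \<partial>\<nu>) = 0" using int1 mean by (simp add: \<nu>.prob_space)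
  have cube: "(x - 1) ^ 3 = x ^ 3 - 3 * x\<^sup>2 + 3 * x - 1" for x :: real
    by (simp add: power3_eq_cube power2_eq_square algebra_simps)
  have int3': "integrable \<nu> (\<lambda>x. \<bar>x - 1\<bar> ^ 3)"
    unfolding power_abs[symmetric] cube using int1 int2 int3 by (intro integrable_abs) simp
  have X: "X n e \<in> borel_measurable (M n)" if "e \<in> Knn_edges n" for n e
    using indep[of n] that unfolding prob_space.indep_vars_def[OF prob] by auto
  have edge: "(0, 0) \<in> Knn_edges 1" by (simp add: Knn_edges_def)
  have AE_nonneg: "AE x in \<nu>. 0 \<le> x"
    unfolding law[OF edge, symmetric] using X[OF edge] nonneg by (subst AE_distr_iff) auto
  have L: "?L n \<in> borel_measurable (M n)" for n
    using X by (intro borel_measurable_sum) (auto intro!: borel_measurable_ln)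
  have Z: "?Z n \<in> borel_measurable (M n)" for n
    unfolding normalized_permanent_def using X subsetD[OF perfect_matching_subset]
    by (intro borel_measurable_divide borel_measurable_sum borel_measurable_prod) (blast intro: borel_measurable_const)+
  show ?thesis
  proof (rule tendsto_cdf_exp_perturbation[where M = M and L = ?L, OF prob L Z _ _ _ cont])
    show "real_distribution (normal_law (- s / 2) s)"
      using s by (rule real_distribution_normal_law)
    show "weak_conv_m (\<lambda>n. distr (M n) borel (?L n)) (normal_law (- s / 2) s)"
      by (rule weak_conv_log_edge_product[OF prob \<nu> indep law AE_nonneg _ mean' int2' second' int3'])
        (use int1 in simp_all)
    fix \<delta> :: real assume \<delta>: "0 < \<delta>"
    define b where "b = (\<lambda>n::nat. exp s - 2 * (1 + s / n) ^ n + (1 + s / n\<^sup>2) ^ n\<^sup>2)"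
    \<comment> \<open>The limit of \<open>(1 + s / N)^N\<close> along the subsequence
      \<open>N = n^2\<close>.\<close>
    have "(\<lambda>n. (1 + s / real (n\<^sup>2)) ^ n\<^sup>2) \<longlonglongrightarrow> exp s"
      by (rule filterlim_compose[OF tendsto_exp_limit_sequentially])
        (rule filterlim_subseq, simp add: strict_mono_def power_strict_mono)
    then have "b \<longlonglongrightarrow> exp s - 2 * exp s + exp s"
      unfolding b_def by (intro tendsto_intros tendsto_exp_limit_sequentially) simp
    then have lim: "(\<lambda>n. b n / \<delta>\<^sup>2) \<longlonglongrightarrow> 0"
      using tendsto_divide[OF _ tendsto_const, of b 0 sequentially "\<delta>\<^sup>2"] \<delta> by simp
    have le: "measure (M n) {\<xi> \<in> space (M n). \<delta> \<le> \<bar>?Z n \<xi> - exp (?L n \<xi>)\<bar>} \<le> b n / \<delta>\<^sup>2"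
      if n: "2 \<le> n" for n
    proof -
      interpret M: prob_space "M n" by (rule prob)
      have "exp (?L n \<xi>) = ?P n \<xi>" for \<xi>
      proof -
        \<comment> \<open>For \<open>n \<ge> 2\<close> a vanishing weight still leaves a positive
          factor, so \<open>exp\<close> undoes \<open>ln\<close>; for \<open>n = 1\<close> the
          factor could be 0.\<close>
        have "0 < 1 + (X n e \<xi> - 1) / n" for e
        proof -
          have "0 < (real n - 1 + X n e \<xi>) / n" using n nonneg[of n e \<xi>] by (intro divide_pos_pos) auto
          also have "\<dots> = 1 + (X n e \<xi> - 1) / n" using n by (simp add: field_simps)
          finally show ?thesis .
        qed
        then show ?thesis by (simp add: exp_sum finite_Knn_edges edge_product_def)
      qed
      then have eq: "{\<xi> \<in> space (M n). \<delta> \<le> \<bar>?Z n \<xi> - exp (?L n \<xi>)\<bar>}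
          = {\<xi> \<in> space (M n). \<delta>\<^sup>2 \<le> (?Z n \<xi> - ?P n \<xi>)\<^sup>2}"
        using \<delta> abs_le_square_iff[of \<delta>] by simp
      have n0: "0 < n" using n by simp
      note diff = n0 indep law int1 mean int2 second s
      have "measure (M n) {\<xi> \<in> space (M n). \<delta>\<^sup>2 \<le> (?Z n \<xi> - ?P n \<xi>)\<^sup>2}
          \<le> (\<integral>\<xi>. (?Z n \<xi> - ?P n \<xi>)\<^sup>2 \<partial>M n) / \<delta>\<^sup>2"
        using \<delta> M.integrable_permanent_diff[OF \<nu> diff]
        by (intro integral_Markov_inequality_measure[where A = "{}"]) auto
      also have "\<dots> \<le> b n / \<delta>\<^sup>2"
        unfolding b_def by (intro divide_right_mono M.expectation_permanent_diff_le[OF \<nu> diff]) simp_all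
      finally show ?thesis unfolding eq .
    qed
    show "(\<lambda>n. measure (M n) {\<xi> \<in> space (M n). \<delta> \<le> \<bar>?Z n \<xi> - exp (?L n \<xi>)\<bar>}) \<longlonglongrightarrow> 0"
      by (rule tendsto_sandwich[OF _ eventually_mono[OF eventually_ge_at_top[of 2] le] tendsto_const lim]) simp
  qed
qed

section \<open>Reduction of the partition function to a normalized permanent\<close>

section \<open>The partition function\<close>

lemma boltzmann_nonneg: "0 \<le> boltzmann \<beta> w"
  by (simp add: boltzmann_def)

text \<open>The case \<open>k = 0\<close> is excluded because at \<open>w = \<infinity>\<close> the
  power would be 1, while \<open>boltzmann 0 \<infinity> = 0\<close>.\<close>

lemma boltzmann_power: "boltzmann \<beta> w ^ k = boltzmann (k * \<beta>) w" if "0 < k"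
  using that by (simp add: boltzmann_def exp_of_nat_mult[symmetric] algebra_simps)

text \<open>If a weight is \<open>\<infinity>\<close>, both sides are 0. At
  \<open>-\<infinity>\<close> the conversion to a real returns 0, and multiplicativity would fail in
  general.\<close>

lemma boltzmann_add:
  assumes "a \<noteq> -\<infinity>" "b \<noteq> -\<infinity>"
  shows "boltzmann \<beta> (a + b) = boltzmann \<beta> a * boltzmann \<beta> b"
  using assms by (cases a; cases b) (auto simp: boltzmann_def algebra_simps exp_add[symmetric])

lemma boltzmann_matching_weight:
  assumes "finite \<pi>" "\<And>e. e \<in> \<pi> \<Longrightarrow> w e \<noteq> -\<infinity>"
  shows "boltzmann \<beta> (matching_weight w \<pi>) = (\<Prod>e\<in>\<pi>. boltzmann \<beta> (w e))"
proof -
  \<comment> \<open>The induction also carries that the partial sum is not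
    \<open>-\<infinity>\<close>, as required to split off the next edge.\<close>
  have "matching_weight w \<pi> \<noteq> -\<infinity> \<and> boltzmann \<beta> (matching_weight w \<pi>) = (\<Prod>e\<in>\<pi>. boltzmann \<beta> (w e))"
    using assms unfolding matching_weight_def
  proof (induction \<pi> rule: finite_induct)
    case empty
    then show ?case by (simp add: boltzmann_def)
  next
    case (insert e \<pi>)
    then show ?case by (auto simp: boltzmann_add)
  qed
  then show ?thesis ..
qed

text \<open>Every perfect matching has exactly \<open>n\<close> edges, so rescaling each edge by
  \<open>c\<close> costs the common factor \<open>c^n\<close>.\<close>

lemma partition_function_eq_permanent:
  assumes "\<And>e. e \<in> Knn_edges n \<Longrightarrow> w e \<noteq> -\<infinity>" and c: "c \<noteq> 0"
  shows "partition_function n \<beta> w = c ^ n * normalized_permanent n (\<lambda>e. boltzmann \<beta> (w e) / c)"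
proof -
  have "boltzmann \<beta> (matching_weight w \<pi>) = c ^ n * (\<Prod>e\<in>\<pi>. boltzmann \<beta> (w e) / c)"
    if \<pi>: "\<pi> \<in> perfect_matchings n" for \<pi>
  proof -
    have "finite \<pi>" using perfect_matching_subset[OF \<pi>] finite_Knn_edges finite_subset by blast
    then have "boltzmann \<beta> (matching_weight w \<pi>) = (\<Prod>e\<in>\<pi>. boltzmann \<beta> (w e))"
      using perfect_matching_subset[OF \<pi>] assms(1) by (intro boltzmann_matching_weight) auto
    then show ?thesis
      using c card_perfect_matching[OF \<pi>] by (simp add: prod_dividef)
  qed
  then show ?thesis
    by (simp add: partition_function_def normalized_permanent_def sum_distrib_left[symmetric])
qed

text \<open>Rewrites events about the logarithm as events about \<open>z\<close>. At
  \<open>z = 0\<close> both sides are true, so the value \<open>-\<infinity>\<close> needs no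
  treatment in the limit theorems.\<close>

lemma log_ext_le_iff:
  assumes "0 < c" "0 \<le> z"
  shows "log_ext (c ^ n * z) - ereal (n * ln c) \<le> ereal x \<longleftrightarrow> z \<le> exp x"
proof (cases "z = 0")
  case True
  then show ?thesis by (simp add: log_ext_def)
next
  case False
  then have "0 < z" using assms by simp
  then have "ln (c ^ n * z) - n * ln c = ln z"
    using assms by (simp add: ln_mult ln_realpow)
  then have "log_ext (c ^ n * z) - ereal (n * ln c) = ereal (ln z)"
    using assms False by (simp add: log_ext_def)
  moreover have "ln z \<le> x \<longleftrightarrow> z \<le> exp x"
    using \<open>0 < z\<close> by (metis exp_le_cancel_iff exp_ln)
  ultimately show ?thesis by simp
qed

theorem theorem1p1:
  fixes M :: "nat \<Rightarrow> 'a measure"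
    and \<omega> :: "nat \<Rightarrow> nat \<times> nat \<Rightarrow> 'a \<Rightarrow> ereal"
    and \<mu> :: "ereal measure"
    and \<beta> :: real
  assumes prob: "\<And>n. prob_space (M n)"
    and indep: "\<And>n. prob_space.indep_vars (M n) (\<lambda>_. borel) (\<omega> n) (Knn_edges n)"
    and law: "\<And>n e. e \<in> Knn_edges n \<Longrightarrow> distr (M n) borel (\<omega> n e) = \<mu>"
    and not_minus_infinity:
      "\<And>n e \<xi>. e \<in> Knn_edges n \<Longrightarrow> \<xi> \<in> space (M n) \<Longrightarrow> \<omega> n e \<xi> \<noteq> -\<infinity>"
    and not_as_infinity: "\<not> (AE w in \<mu>. w = \<infinity>)"
    and finite_mgf: "\<And>b. b \<ge> 0 \<Longrightarrow> integrable \<mu> (boltzmann b)"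
    and beta: "\<beta> \<ge> 0"
  shows "converges_in_distribution M
    (\<lambda>n \<xi>. log_ext (partition_function n \<beta> (\<lambda>e. \<omega> n e \<xi>)) - ereal (real n * log_mgf \<mu> \<beta>))
    (normal_law (- limit_variance \<mu> \<beta> / 2) (limit_variance \<mu> \<beta>))"
proof -
  have \<omega>: "\<omega> n e \<in> borel_measurable (M n)" if "e \<in> Knn_edges n" for n e
    using indep[of n] that unfolding prob_space.indep_vars_def[OF prob] by auto
  have edge: "(0, 0) \<in> Knn_edges 1" by (simp add: Knn_edges_def)
  have sets: "sets \<mu> = sets borel" unfolding law[OF edge, symmetric] by simp
  interpret \<mu>: prob_space \<mu>
    unfolding law[OF edge, symmetric] by (intro prob_space.prob_space_distr prob \<omega> edge)
  \<comment> \<open>A nonnegative function with zero integral vanishes almost everywhere, which here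
    would make the weight almost surely \<open>\<infinity>\<close>.\<close>
  have boltzmann_pos: "0 < (\<integral>w. boltzmann b w \<partial>\<mu>)" if "0 \<le> b" for b
  proof -
    have "(\<integral>w. boltzmann b w \<partial>\<mu>) \<noteq> 0"
    proof
      assume "(\<integral>w. boltzmann b w \<partial>\<mu>) = 0"
      then have "AE w in \<mu>. boltzmann b w = 0"
        using integral_nonneg_eq_0_iff_AE[OF finite_mgf[OF that]] boltzmann_nonneg by simp
      then have "AE w in \<mu>. w = \<infinity>"
        by eventually_elim (simp add: boltzmann_def split: if_splits)
      then show False using not_as_infinity by simp
    qed
    moreover have "0 \<le> (\<integral>w. boltzmann b w \<partial>\<mu>)"
      by (intro integral_nonneg_AE) (simp add: boltzmann_nonneg)
    ultimately show ?thesis by simp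
  qed
  \<comment> \<open>\<open>c\<close> is the exponential of \<open>\<psi>(\<beta>)\<close>; dividing
    by it gives the edge variables mean 1.\<close>
  define c where "c = (\<integral>w. boltzmann \<beta> w \<partial>\<mu>)"
  define c2 where "c2 = (\<integral>w. boltzmann (2 * \<beta>) w \<partial>\<mu>)"
  have c: "0 < c" "0 < c2" using boltzmann_pos beta by (simp_all add: c_def c2_def)
  define g where "g = (\<lambda>w. boltzmann \<beta> w / c)"
  have g: "g \<in> borel_measurable borel"
    using borel_measurable_integrable[OF finite_mgf[OF beta]]
    by (simp add: g_def measurable_cong_sets[OF sets refl])
  then have g': "g \<in> borel_measurable \<mu>"
    by (simp add: measurable_cong_sets[OF sets refl])
  define \<nu> where "\<nu> = distr \<mu> borel g"
  \<comment> \<open>Up to scaling, the \<open>k\<close>-th moment is the Boltzmann integral at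
    \<open>k * \<beta>\<close>, finite by hypothesis. For \<open>k = 0\<close> the integrand is the
    constant 1, also at infinite weight.\<close>
  have int: "integrable \<nu> (\<lambda>x. x ^ k)" for k
  proof (cases "k = 0")
    case False
    have "integrable \<mu> (\<lambda>w. boltzmann (k * \<beta>) w / c ^ k)"
      using finite_mgf[of "k * \<beta>"] beta by simp
    then show ?thesis
      using False g' by (simp add: \<nu>_def integrable_distr_eq g_def power_divide boltzmann_power)
  next
    case True
    interpret prob_space \<nu> unfolding \<nu>_def by (rule \<mu>.prob_space_distr[OF g'])
    show ?thesis using True by simp
  qed
  have mean: "(\<integral>x. x \<partial>\<nu>) = 1"
    using c g' by (simp add: \<nu>_def integral_distr g_def c_def[symmetric])
  have "exp (log_mgf \<mu> (2 * \<beta>) - 2 * log_mgf \<mu> \<beta>) = c2 / c\<^sup>2"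
    using c by (simp add: log_mgf_def c_def[symmetric] c2_def[symmetric] exp_diff exp_double)
  then have second: "(\<integral>x. x\<^sup>2 \<partial>\<nu>) = 1 + limit_variance \<mu> \<beta>"
    using g' by (simp add: \<nu>_def integral_distr g_def limit_variance_def power_divide
      boltzmann_power c2_def)
  define X where "X = (\<lambda>n e \<xi>. g (\<omega> n e \<xi>))"
  have indep_X: "prob_space.indep_vars (M n) (\<lambda>_. borel) (X n) (Knn_edges n)" for n
    unfolding X_def by (rule prob_space.indep_vars_compose2[OF prob indep g])
  have law_X: "distr (M n) borel (X n e) = \<nu>" if "e \<in> Knn_edges n" for n e
    unfolding \<nu>_def law[OF that, symmetric] distr_distr[OF g \<omega>[OF that]] by (simp add: X_def comp_def)
  have X_nonneg: "0 \<le> X n e \<xi>" for n e \<xi>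
    using c by (simp add: X_def g_def boltzmann_nonneg)
  \<comment> \<open>The equality of events is pointwise on the whole space, since no weight ever
    takes the value \<open>-\<infinity>\<close> there.\<close>
  have event: "{\<xi> \<in> space (M n). log_ext (partition_function n \<beta> (\<lambda>e. \<omega> n e \<xi>))
        - ereal (real n * log_mgf \<mu> \<beta>) \<le> ereal x}
      = {\<xi> \<in> space (M n). normalized_permanent n (\<lambda>e. X n e \<xi>) \<le> exp x}" for n x
  proof (intro Collect_cong conj_cong refl)
    fix \<xi> assume \<xi>: "\<xi> \<in> space (M n)"
    have "partition_function n \<beta> (\<lambda>e. \<omega> n e \<xi>) = c ^ n * normalized_permanent n (\<lambda>e. X n e \<xi>)"
      unfolding X_def g_def using not_minus_infinity \<xi> c by (intro partition_function_eq_permanent) auto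
    moreover have "0 \<le> normalized_permanent n (\<lambda>e. X n e \<xi>)"
      unfolding normalized_permanent_def by (intro divide_nonneg_nonneg sum_nonneg prod_nonneg) (auto simp: X_nonneg)
    ultimately show "log_ext (partition_function n \<beta> (\<lambda>e. \<omega> n e \<xi>)) - ereal (real n * log_mgf \<mu> \<beta>) \<le> ereal x
        \<longleftrightarrow> normalized_permanent n (\<lambda>e. X n e \<xi>) \<le> exp x"
      using log_ext_le_iff[OF c(1)] by (simp add: log_mgf_def c_def[symmetric])
  qed
  have \<nu>: "prob_space \<nu>" unfolding \<nu>_def by (rule \<mu>.prob_space_distr[OF g'])
  show ?thesis
    unfolding converges_in_distribution_def weak_conv_def event
    using tendsto_prob_normalized_permanent_le[OF prob \<nu> indep_X law_X X_nonneg int mean second] by blast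
qed

end
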